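(* Fix integers $n\geq k\geq 3$ and $t\in[-1/(k-1),1)$. Let $\gamma\geq 0$ satisfy $\gamma\geq \alpha_m(S^{n-2},k-1,t/(1+t))$. Then $$\alpha_m(S^{n-1},k,t)\leq \sup\Big\{\int_{S^{n-1}}\int_{S^{n-1}} f(x\cdot y)\,d\omega(y)\,d\omega(x)\Big\},$$ where the supremum is over all continuous $f\colon[-1,1]\to\mathbb{R}$ of positive type for $S^{n-1}$ with $f(1)=1$ and $f(t)\leq\gamma$.
   Context: $S^{n-1}=\{x\in\mathbb{R}^n:\|x\|=1\}$, and $\omega$ denotes the surface measure on the sphere normalized to total measure $1$. A set of $k\geq 2$ points $\{x_1,\dots,x_k\}\subseteq S^{n-1}$ is a $(k,t)$-simplex if $x_i\cdot x_j=t$ for all $i\neq j$. A set avoids $(k,t)$-simplices if no $k$ of its points form a $(k,t)$-simplex. $\alpha_m(S^{n-1},k,t)$ is the supremum of $\omega(I)$ over measurable $I\subseteq S^{n-1}$ avoiding $(k,t)$-simplices. A continuous $f\colon[-1,1]\to\mathbb{R}$ is of positive type for $S^{n-1}$ if for every finite $U\subseteq S^{n-1}$ the matrix $(f(x\cdot y))_{x,y\in U}$ is positive semidefinite. *)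

theory Defs
  imports "HOL-Analysis.Analysis"
begin

text \<open>
  The normalized surface measure \<open>\<omega>\<close> on the unit sphere is given as the cone measure:
  \<open>\<omega> A\<close> is the proportion of the volume of the unit ball taken up by the cone of those \<open>x\<close>
  whose radial projection \<open>x / norm x = sgn x\<close> lies in \<open>A\<close>.  (The point \<open>sgn 0 = 0\<close> off the
  sphere carries no mass.)  The underlying space is the sphere itself, and the measure is
  completed, so that ``measurable'' means measurable in the sense of Lebesgue.
\<close>

definition sphere_measure :: "'a::euclidean_space measure" where
  "sphere_measure =
     completion (restrict_space (distr (uniform_measure lborel (ball 0 1)) borel sgn) (sphere 0 1))"

definition is_simplex :: "nat \<Rightarrow> real \<Rightarrow> 'a::euclidean_space set \<Rightarrow> bool" where
  "is_simplex k t X \<longleftrightarrow>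
     2 \<le> k \<and> X \<subseteq> sphere 0 1 \<and> card X = k \<and> (\<forall>x\<in>X. \<forall>y\<in>X. x \<noteq> y \<longrightarrow> x \<bullet> y = t)"

definition avoids_simplices :: "nat \<Rightarrow> real \<Rightarrow> 'a::euclidean_space set \<Rightarrow> bool" where
  "avoids_simplices k t I \<longleftrightarrow> \<not> (\<exists>X\<subseteq>I. is_simplex k t X)"

text \<open>
  The sphere is the unit sphere of the type passed as first argument.  For \<open>k \<ge> 2\<close> the set
  under the supremum contains \<open>0\<close> (take \<open>I = {}\<close>), and it is bounded by \<open>1\<close>.
\<close>

definition alpha_m :: "'a::euclidean_space itself \<Rightarrow> nat \<Rightarrow> real \<Rightarrow> real" where
  "alpha_m _ k t =
     Sup {measure sphere_measure I | I :: 'a set.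
            I \<in> sets sphere_measure \<and> avoids_simplices k t I}"

text \<open>
  Positive semidefiniteness of the matrix with entries \<open>f (x \<bullet> y)\<close>, whose symmetry is automatic.
  Only the values of \<open>f\<close> on \<open>{-1..1}\<close> matter.
\<close>

definition positive_type :: "'a::euclidean_space itself \<Rightarrow> (real \<Rightarrow> real) \<Rightarrow> bool" where
  "positive_type _ f \<longleftrightarrow>
     (\<forall>U :: 'a set. finite U \<longrightarrow> U \<subseteq> sphere 0 1 \<longrightarrow>
        (\<forall>c :: 'a \<Rightarrow> real. 0 \<le> (\<Sum>x\<in>U. \<Sum>y\<in>U. c x * f (x \<bullet> y) * c y)))"

lemma space_sphere_measure: "space (sphere_measure :: 'a::euclidean_space measure) = sphere 0 1"
  by (simp add: sphere_measure_def space_restrict_space)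

lemma emeasure_sphere_measure_borel:
  fixes A :: "'a::euclidean_space set"
  assumes "A \<in> sets borel" "A \<subseteq> sphere 0 1"
  shows "emeasure sphere_measure A
       = emeasure lborel {x \<in> ball 0 1. sgn x \<in> A} / emeasure lborel (ball (0::'a) 1)"
proof -
  let ?U = "uniform_measure lborel (ball (0::'a) 1)"
  have sgn: "sgn \<in> borel_measurable (borel :: 'a measure)"
    unfolding sgn_div_norm by measurable
  have sgnU: "sgn \<in> measurable ?U borel"
    using sgn by (simp cong: measurable_cong_sets)
  have sets: "A \<in> sets (restrict_space (distr ?U borel sgn) (sphere 0 1))"
    using assms by (auto simp: sets_restrict_space_iff)
  have pre: "sgn -` A \<in> sets (borel :: 'a measure)"
    using measurable_sets[OF sgn assms(1)] by simp
  have "emeasure sphere_measure A = emeasure (distr ?U borel sgn) A"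
    unfolding sphere_measure_def using sets assms
    by (simp add: emeasure_restrict_space)
  also have "\<dots> = emeasure ?U (sgn -` A)"
    using emeasure_distr[OF sgnU assms(1)] by simp
  also have "\<dots> = emeasure lborel (ball 0 1 \<inter> sgn -` A) / emeasure lborel (ball (0::'a) 1)"
    using pre by (intro emeasure_uniform_measure) simp_all
  also have "ball 0 1 \<inter> sgn -` A = {x \<in> ball 0 1. sgn x \<in> A}" by auto
  finally show ?thesis .
qed

lemma emeasure_sphere_measure_sphere:
  "emeasure sphere_measure (sphere (0::'a::euclidean_space) 1) = 1"
proof -
  let ?B = "ball (0::'a) 1"
  have fin: "emeasure lborel ?B < \<infinity>"
    using emeasure_lborel_ball_finite[of "0::'a" 1] by simp
  have pos: "emeasure lborel ?B \<noteq> 0"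
    using content_ball_pos[of 1 "0::'a"] by (auto simp: measure_def)
  have "{x \<in> ?B. sgn x \<in> sphere 0 1} = ?B - {0}"
    by (auto simp: norm_sgn)
  moreover have "emeasure lborel (?B - {0}) = emeasure lborel ?B"
    by (rule emeasure_Diff_null_set) auto
  ultimately show ?thesis
    using fin pos by (simp add: emeasure_sphere_measure_borel ennreal_divide_self)
qed

end

theory Submission
  imports Defs "HOL-Probability.Infinite_Product_Measure"
begin

text \<open>
  Let \<open>R\<close> be a random rotation and \<open>I\<close> a simplex-avoiding set of positive measure. The probability
  that \<open>R x\<close> and \<open>R y\<close> both lie in \<open>I\<close> depends only on \<open>x \<bullet> y\<close>; divided by \<open>\<omega> I\<close> it is a continuous
  function \<open>f\<close> of positive type with \<open>f 1 = 1\<close> whose double integral is \<open>\<omega> I\<close>. Given that \<open>R x = p\<close> lies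
  in \<open>I\<close>, the point \<open>R y\<close> is uniform on the points at inner product \<open>t\<close> with \<open>p\<close>, a sphere of one dimension
  less in which \<open>I\<close> leaves a set without \<open>(k - 1, t / (1 + t))\<close>-simplices; hence \<open>f t \<le> \<gamma>\<close>.

  Haar measure on the orthogonal group is avoided: \<open>R\<close> takes the coordinates with respect to the
  Gram-Schmidt orthonormalization of independent uniform points \<open>v\<^sub>0, \<dots>, v\<^sub>n\<^sub>-\<^sub>1\<close> of the sphere. Applying an orthogonal
  map \<open>S\<close> to all \<open>v\<^sub>i\<close> turns \<open>R\<close> into \<open>R \<circ> S\<inverse>\<close>, so \<open>R\<close> is invariant in distribution under \<open>S\<close> on the right.
  Invariance on the left is not needed, because Fubini's theorem transfers it from the averaged
  measure on the sphere.
\<close>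

section \<open>Rotation invariance of the uniform measure on the sphere\<close>

lemma nn_integral_lborel_translate:
  fixes c :: "'a::euclidean_space"
  assumes "f \<in> borel_measurable borel"
  shows "(\<integral>\<^sup>+x. f (c + x) \<partial>lborel) = (\<integral>\<^sup>+x. f x \<partial>lborel)"
  by (subst (2) lborel_distr_plus[of c, symmetric]) (use assms in \<open>simp add: nn_integral_distr\<close>)

lemma emeasure_lborel_ball_translate:
  fixes y :: "'a::euclidean_space"
  shows "emeasure lborel (ball y r) = emeasure lborel (ball (0::'a) r)"
proof -
  have "emeasure lborel (ball y r) = (\<integral>\<^sup>+x. indicator (ball y r) (y + x) \<partial>lborel)"
    by (subst nn_integral_lborel_translate) (auto intro!: borel_measurable_indicator)
  also have "\<dots> = (\<integral>\<^sup>+x. indicator (ball (0::'a) r) x \<partial>lborel)"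
    by (intro nn_integral_cong) (auto simp: indicator_def dist_norm)
  finally show ?thesis by simp
qed

lemma orthogonal_transformation_measurable:
  "orthogonal_transformation (T :: 'a::euclidean_space \<Rightarrow> 'a) \<Longrightarrow> T \<in> borel_measurable borel"
  using linear_continuous_on[OF linear_conv_bounded_linear[THEN iffD1, OF orthogonal_transformation_linear]]
  by (intro borel_measurable_continuous_onI) auto

text \<open>
  Counting the pairs \<open>(x, y)\<close> with \<open>T x + y \<in> A\<close> and \<open>y\<close> in the unit ball in both orders shows that
  \<open>T\<close> scales Lebesgue measure by the factor with which it scales the unit ball.
\<close>

lemma lborel_distr_orthogonal:
  fixes T :: "'a::euclidean_space \<Rightarrow> 'a"
  assumes T: "orthogonal_transformation T"
  shows "distr lborel borel T = lborel"
proof (rule measure_eqI)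
  fix A assume "A \<in> sets (distr lborel borel T)"
  then have A [measurable]: "A \<in> sets borel" by simp
  have T_m [measurable]: "T \<in> borel_measurable borel"
    using T by (rule orthogonal_transformation_measurable)
  let ?B = "ball (0::'a) 1"
  have B [measurable]: "?B \<in> sets borel" by simp
  define S where "S = inv T"
  have lin: "linear T" using T by (rule orthogonal_transformation_linear)
  have TS: "T (S y) = y" for y
    unfolding S_def using orthogonal_transformation_bij[OF T] by (simp add: bij_is_surj surj_f_inv_f)
  have nrm: "norm (T x) = norm x" for x using T by (simp add: orthogonal_transformation_norm)
  have TA [measurable]: "T -` A \<in> sets borel" using measurable_sets[OF T_m A] by simp
  have "emeasure lborel (T -` A) * emeasure lborel ?B
      = (\<integral>\<^sup>+y. emeasure lborel (T -` A) * indicator ?B y \<partial>lborel)"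
    by (subst nn_integral_cmult_indicator) auto
  also have "\<dots> = (\<integral>\<^sup>+y. (\<integral>\<^sup>+x. indicator A (T x + y) * indicator ?B y \<partial>lborel) \<partial>lborel)"
  proof (rule nn_integral_cong)
    fix y :: 'a
    have "emeasure lborel (T -` A) = (\<integral>\<^sup>+x. indicator (T -` A) x \<partial>lborel)" by simp
    \<comment> \<open>Since \<open>T (S y) = y\<close>, shifting the argument by \<open>S y\<close>
      shifts its image under \<open>T\<close> by \<open>y\<close>.\<close>
    also have "\<dots> = (\<integral>\<^sup>+x. indicator (T -` A) (S y + x) \<partial>lborel)"
      by (rule nn_integral_lborel_translate[symmetric]) simp
    also have "\<dots> = (\<integral>\<^sup>+x. indicator A (T x + y) \<partial>lborel)"
      by (intro nn_integral_cong) (auto simp: indicator_def linear_add[OF lin] TS add.commute)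
    finally show "emeasure lborel (T -` A) * indicator ?B y
      = (\<integral>\<^sup>+x. indicator A (T x + y) * indicator ?B y \<partial>lborel)"
      by (simp add: nn_integral_multc)
  qed
  also have "\<dots> = (\<integral>\<^sup>+x. (\<integral>\<^sup>+y. indicator A (T x + y) * indicator ?B y \<partial>lborel) \<partial>lborel)"
    by (rule lborel_pair.Fubini') measurable
  also have "\<dots> = (\<integral>\<^sup>+x. (\<integral>\<^sup>+y. indicator A y * indicator ?B (y - T x) \<partial>lborel) \<partial>lborel)"
  proof (rule nn_integral_cong)
    fix x :: 'a
    show "(\<integral>\<^sup>+y. indicator A (T x + y) * indicator ?B y \<partial>lborel)
      = (\<integral>\<^sup>+y. indicator A y * indicator ?B (y - T x) \<partial>lborel)"
      using nn_integral_lborel_translate[of "\<lambda>y. indicator A y * indicator ?B (y - T x)" "T x"]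
      by simp
  qed
  also have "\<dots> = (\<integral>\<^sup>+y. (\<integral>\<^sup>+x. indicator A y * indicator ?B (y - T x) \<partial>lborel) \<partial>lborel)"
    by (rule lborel_pair.Fubini') measurable
  also have "\<dots> = (\<integral>\<^sup>+y. indicator A y * emeasure lborel ?B \<partial>lborel)"
  proof (rule nn_integral_cong)
    fix y :: 'a
    \<comment> \<open>Because \<open>y - T x = T (S y - x)\<close>, the condition on
      \<open>x\<close> describes the unit ball around \<open>S y\<close>, which has the volume of
      the one around \<open>0\<close>.\<close>
    have "norm (y - T x) = dist (S y) x" for x
      using nrm[of "S y - x"] by (simp add: linear_diff[OF lin] TS dist_norm)
    then have "indicator ?B (y - T x) = (indicator (ball (S y) 1) x :: ennreal)" for x
      by (auto simp: indicator_def dist_norm norm_minus_commute)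
    then have "(\<integral>\<^sup>+x. indicator A y * indicator ?B (y - T x) \<partial>lborel)
      = (\<integral>\<^sup>+x. indicator A y * indicator (ball (S y) 1) x \<partial>lborel)" by simp
    also have "\<dots> = indicator A y * emeasure lborel ?B"
      by (subst nn_integral_cmult_indicator) (simp_all add: emeasure_lborel_ball_translate[of "S y"])
    finally show "(\<integral>\<^sup>+x. indicator A y * indicator ?B (y - T x) \<partial>lborel)
      = indicator A y * emeasure lborel ?B" .
  qed
  also have "\<dots> = emeasure lborel A * emeasure lborel ?B"
    by (simp add: nn_integral_multc)
  finally have eq: "emeasure lborel ?B * emeasure lborel (T -` A)
    = emeasure lborel ?B * emeasure lborel A" by (simp add: mult.commute)
  moreover have "emeasure lborel ?B \<noteq> \<infinity>" "emeasure lborel ?B \<noteq> 0"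
    using emeasure_lborel_ball_finite[of "0::'a" 1] content_ball_pos[of 1 "0::'a"]
    by (auto simp: measure_def)
  ultimately show "emeasure (distr lborel borel T) A = emeasure lborel A"
    by (simp add: emeasure_distr ennreal_mult_cancel_left)
qed simp

text \<open>The surface measure before restriction to the sphere and completion. As a Borel measure
  on the whole space it combines with \<open>distr\<close> and with products under plain Borel
  measurability; that it lives on the sphere is recorded by \<open>AE_usphere_norm\<close>.\<close>

definition usphere :: "'a::euclidean_space measure" where
  "usphere = distr (uniform_measure lborel (ball 0 1)) borel sgn"

lemma borel_measurable_sgn [measurable]:
  "sgn \<in> borel_measurable (borel :: 'a::euclidean_space measure)"
  unfolding sgn_div_norm by measurable

lemma sets_usphere [simp, measurable_cong]: "sets usphere = sets borel"
  and space_usphere [simp]: "space usphere = UNIV"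
  by (auto simp: usphere_def)

lemma emeasure_usphere:
  fixes A :: "'a::euclidean_space set"
  assumes [measurable]: "A \<in> sets borel"
  shows "emeasure usphere A
    = emeasure lborel (ball 0 1 \<inter> sgn -` A) / emeasure lborel (ball (0::'a) 1)"
proof -
  have "sgn -` A \<in> sets (borel :: 'a measure)"
    using measurable_sets[OF borel_measurable_sgn assms] by simp
  then show ?thesis
    unfolding usphere_def by (subst emeasure_distr) (auto simp: emeasure_uniform_measure)
qed

lemma sphere_measure_eq: "sphere_measure = completion (restrict_space usphere (sphere 0 1))"
  by (simp add: sphere_measure_def usphere_def)

lemma prob_space_usphere: "prob_space (usphere :: 'a::euclidean_space measure)"
proof -
  have "emeasure lborel (ball (0::'a) 1) \<noteq> \<infinity>" "emeasure lborel (ball (0::'a) 1) \<noteq> 0"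
    using emeasure_lborel_ball_finite[of "0::'a" 1] content_ball_pos[of 1 "0::'a"]
    by (auto simp: measure_def)
  then show ?thesis
    unfolding usphere_def by (intro prob_space.prob_space_distr prob_space_uniform_measure) auto
qed

interpretation usphere: prob_space "usphere :: 'a::euclidean_space measure"
  by (rule prob_space_usphere)

text \<open>A point whose direction lies in \<open>V\<close> lies in \<open>V\<close> itself, so the
  cone over \<open>V\<close> is contained in a proper subspace, a Lebesgue null set.\<close>

lemma usphere_null_subspace:
  fixes V :: "'a::euclidean_space set"
  assumes "subspace V" "dim V < DIM('a)"
  shows "emeasure usphere V = 0"
proof -
  have V [measurable]: "V \<in> sets borel" using closed_subspace[OF assms(1)] by simp
  have "x \<in> V" if "sgn x \<in> V" for x
    using subspace_scale[OF assms(1) that, of "norm x"] by (cases "x = 0") (auto simp: sgn_div_norm)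
  then have "ball 0 1 \<inter> sgn -` V \<subseteq> V" by auto
  then have "emeasure lborel (ball 0 1 \<inter> sgn -` V) \<le> emeasure lborel V"
    by (intro emeasure_mono) auto
  also have "emeasure lborel V = 0"
    using negligible_lowdim[OF assms(2)] V
    by (simp add: negligible_iff_null_sets null_sets_def)
  finally show ?thesis by (simp add: emeasure_usphere)
qed

lemma AE_usphere_notin_subspace:
  fixes V :: "'a::euclidean_space set"
  assumes "subspace V" "dim V < DIM('a)"
  shows "AE x in usphere. x \<notin> V"
  using usphere_null_subspace[OF assms] closed_subspace[OF assms(1)]
  by (intro AE_I[of _ _ V]) auto

lemma AE_usphere_norm: "AE x in (usphere :: 'a::euclidean_space measure). norm x = 1"
proof -
  have "AE x in (usphere :: 'a measure). x \<notin> {0}"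
    by (rule AE_usphere_notin_subspace) auto
  moreover have "AE x in (usphere :: 'a measure). x = 0 \<or> norm x = 1"
    unfolding usphere_def by (subst AE_distr_iff) (auto simp: norm_sgn)
  ultimately show ?thesis by eventually_elim auto
qed

lemma sgn_orthogonal:
  "orthogonal_transformation T \<Longrightarrow> sgn (T x) = T (sgn x)"
  by (simp add: sgn_div_norm orthogonal_transformation_norm linear_cmul orthogonal_transformation_linear)

text \<open>An orthogonal map commutes with \<open>sgn\<close> and preserves the unit ball and
  Lebesgue measure, hence the volume of the cones that define \<open>usphere\<close>.\<close>

lemma usphere_distr_orthogonal:
  fixes T :: "'a::euclidean_space \<Rightarrow> 'a"
  assumes T: "orthogonal_transformation T"
  shows "distr usphere borel T = usphere"
proof (rule measure_eqI)
  fix A assume "A \<in> sets (distr usphere borel T)"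
  then have A [measurable]: "A \<in> sets borel" by simp
  have T_m [measurable]: "T \<in> borel_measurable borel"
    using T by (rule orthogonal_transformation_measurable)
  have TA [measurable]: "T -` A \<in> sets borel" using measurable_sets[OF T_m A] by simp
  have sA [measurable]: "sgn -` A \<in> sets borel"
    using measurable_sets[OF borel_measurable_sgn A] by simp
  have "emeasure lborel (ball 0 1 \<inter> sgn -` T -` A) = emeasure lborel (T -` (ball 0 1 \<inter> sgn -` A))"
    by (rule arg_cong[where f="emeasure lborel"])
      (auto simp: sgn_orthogonal[OF T] orthogonal_transformation_norm[OF T])
  also have "\<dots> = emeasure (distr lborel borel T) (ball 0 1 \<inter> sgn -` A)"
    by (simp add: emeasure_distr)
  also have "\<dots> = emeasure lborel (ball 0 1 \<inter> sgn -` A)"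
    by (simp add: lborel_distr_orthogonal[OF T])
  finally show "emeasure (distr usphere borel T) A = emeasure usphere A"
    by (simp add: emeasure_distr emeasure_usphere)
qed simp

text \<open>Away from the origin \<open>sgn\<close> is continuous, so the cone over the ball without
  its apex is open; it contains \<open>e / 2\<close> and therefore has positive volume.\<close>

lemma usphere_ball_pos:
  fixes e :: "'a::euclidean_space"
  assumes e: "norm e = 1" and d: "d > 0"
  shows "emeasure usphere (ball e d) > 0"
proof -
  let ?U = "(ball 0 1 - {0}) \<inter> sgn -` ball e d"
  have "open ?U"
    by (intro continuous_open_preimage) (auto intro!: continuous_intros)
  moreover have "sgn ((1/2) *\<^sub>R e) = e" "(1/2) *\<^sub>R e \<in> ball 0 1 - {0}" using e by (auto simp: sgn_div_norm)
  then have "(1/2) *\<^sub>R e \<in> ?U" using d by simp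
  ultimately have "\<not> negligible ?U" by (intro open_not_negligible) blast+
  then have "emeasure lborel ?U \<noteq> 0"
    using \<open>open ?U\<close> by (simp add: negligible_iff_null_sets null_sets_def)
  moreover have "sgn -` ball e d \<in> sets borel"
    using measurable_sets[OF borel_measurable_sgn, of "ball e d"] by simp
  then have "emeasure lborel ?U \<le> emeasure lborel (ball 0 1 \<inter> sgn -` ball e d)"
    by (intro emeasure_mono) auto
  ultimately show ?thesis
    using emeasure_lborel_ball_finite[of "0::'a" 1]
    by (auto simp: emeasure_usphere zero_less_iff_neq_zero ennreal_divide_eq_0_iff top_unique)
qed

section \<open>Random rotations by Gram-Schmidt orthonormalization\<close>

context
  notes sum.cong [fundef_cong]
begin

text \<open>Normalization by \<open>sgn\<close> keeps the process total: a vector in the span of its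
  predecessors yields \<open>0\<close>. The congruence rule for sums supplies \<open>i < j\<close>
  to the termination proof.\<close>

fun gram_schmidt :: "(nat \<Rightarrow> 'a::euclidean_space) \<Rightarrow> nat \<Rightarrow> 'a" where
  "gram_schmidt v j = sgn (v j - (\<Sum>i<j. (v j \<bullet> gram_schmidt v i) *\<^sub>R gram_schmidt v i))"

end

declare gram_schmidt.simps [simp del]

lemma gram_schmidt_cong:
  "(\<And>i. i \<le> j \<Longrightarrow> v i = w i) \<Longrightarrow> gram_schmidt v j = gram_schmidt w j"
proof (induction j rule: less_induct)
  case (less j)
  then have "gram_schmidt v i = gram_schmidt w i" if "i < j" for i using that by simp
  moreover have "v j = w j" using less.prems by simp
  ultimately show ?case by (simp add: gram_schmidt.simps[of _ j])
qed

lemma norm_gram_schmidt: "gram_schmidt v j \<noteq> 0 \<Longrightarrow> norm (gram_schmidt v j) = 1"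
  by (simp add: gram_schmidt.simps[of v j] norm_sgn sgn_zero_iff)

lemma gram_schmidt_orthogonal: "i < j \<Longrightarrow> gram_schmidt v j \<bullet> gram_schmidt v i = 0"
proof (induction j arbitrary: i rule: less_induct)
  case (less j)
  let ?g = "gram_schmidt v"
  have ort: "?g l \<bullet> ?g i = 0" if "l < j" "l \<noteq> i" for l
    using less.IH[of l i] less.IH[of i l] that less.prems
    by (cases "l < i") (auto simp: inner_commute)
  \<comment> \<open>Only the term \<open>l = i\<close> survives. Its factor
    \<open>?g i \<bullet> ?g i\<close> is \<open>1\<close> unless \<open>?g i = 0\<close>, and in
    that case \<open>v j \<bullet> ?g i\<close> vanishes as well.\<close>
  have "(\<Sum>l<j. (v j \<bullet> ?g l) * (?g l \<bullet> ?g i)) = (\<Sum>l<j. if l = i then (v j \<bullet> ?g i) * (?g i \<bullet> ?g i) else 0)"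
    by (intro sum.cong) (auto simp: ort)
  also have "\<dots> = (v j \<bullet> ?g i) * (?g i \<bullet> ?g i)" using less.prems by simp
  also have "\<dots> = v j \<bullet> ?g i"
    using norm_gram_schmidt[of v i] by (cases "?g i = 0") (auto simp: dot_square_norm)
  finally show ?case
    by (simp add: gram_schmidt.simps[of v j] sgn_div_norm inner_diff_left inner_sum_left)
qed

text \<open>The recursion uses only inner products, linear combinations and \<open>sgn\<close>, all
  of which are compatible with \<open>T\<close>.\<close>

lemma gram_schmidt_orthogonal_transformation:
  assumes T: "orthogonal_transformation T"
  shows "gram_schmidt (\<lambda>i. T (v i)) j = T (gram_schmidt v j)"
proof (induction j rule: less_induct)
  case (less j)
  have lin: "linear T" using T by (rule orthogonal_transformation_linear)
  have inner: "T x \<bullet> T y = x \<bullet> y" for x y using T by (simp add: orthogonal_transformation_def)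
  show ?case
    using less
    by (simp add: gram_schmidt.simps[of _ j] inner sgn_orthogonal[OF T, symmetric] linear_diff[OF lin]
        linear_sum[OF lin] linear_cmul[OF lin])
qed

definition frame_measure :: "(nat \<Rightarrow> 'a::euclidean_space) measure" where
  "frame_measure = Pi\<^sub>M {..<DIM('a)} (\<lambda>_. usphere)"

interpretation frame: prob_space "frame_measure :: (nat \<Rightarrow> 'a::euclidean_space) measure"
  unfolding frame_measure_def by (intro prob_space_PiM prob_space_usphere)

lemma measurable_gram_schmidt [measurable]:
  "j < DIM('a) \<Longrightarrow>
    (\<lambda>v :: nat \<Rightarrow> 'a::euclidean_space. gram_schmidt v j) \<in> borel_measurable frame_measure"
proof (induction j rule: less_induct)
  case (less j)
  then have IH [measurable]:
    "(\<lambda>v :: nat \<Rightarrow> 'a. gram_schmidt v i) \<in> borel_measurable frame_measure" if "i < j" for i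
    using that by simp
  have "(\<lambda>v. v j) \<in> measurable frame_measure (usphere :: 'a measure)"
    unfolding frame_measure_def using less.prems by (intro measurable_component_singleton) auto
  then have [measurable]: "(\<lambda>v. v j) \<in> borel_measurable (frame_measure :: (nat \<Rightarrow> 'a) measure)"
    by (simp cong: measurable_cong_sets)
  show ?case
    by (subst gram_schmidt.simps) measurable
qed

text \<open>With all other vectors fixed, \<open>gram_schmidt v j = 0\<close> forces
  \<open>v j\<close> into the span of the first \<open>j\<close> orthonormalized vectors. These do
  not depend on \<open>v j\<close>, and their span has dimension at most \<open>j\<close>, so it is
  a null set for \<open>v j\<close>.\<close>

lemma AE_gram_schmidt_nonzero:
  "AE v in (frame_measure :: (nat \<Rightarrow> 'a::euclidean_space) measure). \<forall>j<DIM('a). gram_schmidt v j \<noteq> 0"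
proof -
  interpret product_sigma_finite "\<lambda>_::nat. usphere :: 'a measure"
    by (simp add: product_sigma_finite_def usphere.sigma_finite_measure_axioms)
  have "AE v in frame_measure. gram_schmidt v j \<noteq> (0::'a)" if j: "j < DIM('a)" for j
  proof -
    let ?f = "\<lambda>v :: nat \<Rightarrow> 'a. indicator {0} (gram_schmidt v j) :: ennreal"
    let ?I = "{..<DIM('a)} - {j}"
    have f [measurable]: "?f \<in> borel_measurable frame_measure" using j by measurable
    have insert: "insert j ?I = {..<DIM('a)}" using j by auto
    have "(\<integral>\<^sup>+v. ?f v \<partial>frame_measure)
      = (\<integral>\<^sup>+x. (\<integral>\<^sup>+y. ?f (x(j := y)) \<partial>usphere) \<partial>Pi\<^sub>M ?I (\<lambda>_. usphere))"
      using product_nn_integral_insert[of ?I j ?f] f unfolding insert frame_measure_def by blast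
    also have "\<dots> = (\<integral>\<^sup>+x. 0 \<partial>Pi\<^sub>M ?I (\<lambda>_. usphere :: 'a measure))"
    proof (rule nn_integral_cong)
      fix x :: "nat \<Rightarrow> 'a"
      let ?V = "span (gram_schmidt x ` {..<j})"
      have "dim ?V \<le> card (gram_schmidt x ` {..<j})" by (simp add: dim_le_card')
      also have "\<dots> \<le> j" using card_image_le[of "{..<j}" "gram_schmidt x"] by simp
      finally have V: "dim ?V < DIM('a)" using j by simp
      have "?f (x(j := y)) \<le> indicator ?V y" for y
      proof (cases "gram_schmidt (x(j := y)) j = 0")
        case True
        have "gram_schmidt (x(j := y)) i = gram_schmidt x i" if "i < j" for i
          using that by (intro gram_schmidt_cong) auto
        with True have "y = (\<Sum>i<j. (y \<bullet> gram_schmidt x i) *\<^sub>R gram_schmidt x i)"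
          by (simp add: gram_schmidt.simps[of _ j] sgn_zero_iff)
        then have "y \<in> ?V"
          by (metis (no_types, lifting) imageI lessThan_iff span_base span_scale span_sum)
        then show ?thesis by (simp add: indicator_def)
      qed simp
      then have "(\<integral>\<^sup>+y. ?f (x(j := y)) \<partial>usphere) \<le> (\<integral>\<^sup>+y. indicator ?V y \<partial>usphere)"
        by (intro nn_integral_mono) auto
      also have "\<dots> = 0"
        using V closed_subspace[OF subspace_span] by (simp add: usphere_null_subspace)
      finally show "(\<integral>\<^sup>+y. ?f (x(j := y)) \<partial>usphere) = 0" by simp
    qed
    finally have "AE v in frame_measure. ?f v = 0"
      using nn_integral_0_iff_AE[OF f] by simp
    then show ?thesis by (rule eventually_mono) (simp add: indicator_def split: if_splits)
  qed
  then have "AE v in (frame_measure :: (nat \<Rightarrow> 'a) measure). \<forall>j\<in>{..<DIM('a)}. gram_schmidt v j \<noteq> 0"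
    by (subst AE_ball_countable) simp_all
  then show ?thesis by (simp only: Ball_def lessThan_iff)
qed

section \<open>The rotation attached to a frame\<close>

definition enum_basis :: "nat \<Rightarrow> 'a::euclidean_space" where
  "enum_basis = (SOME b. bij_betw b {..<DIM('a)} Basis)"

lemma bij_betw_enum_basis:
  "bij_betw (enum_basis :: nat \<Rightarrow> 'a::euclidean_space) {..<DIM('a)} Basis"
  using someI_ex[OF ex_bij_betw_nat_finite[OF finite_Basis[where ?'a = 'a]]]
  by (simp add: enum_basis_def atLeast0LessThan)

text \<open>For an orthonormal frame this map sends the frame to the standard basis. With this
  direction, rather than its inverse, the value is unchanged when \<open>x\<close> and the frame are
  moved together.\<close>

definition frame_rotation :: "(nat \<Rightarrow> 'a::euclidean_space) \<Rightarrow> 'a \<Rightarrow> 'a" where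
  "frame_rotation v x = (\<Sum>j<DIM('a). (x \<bullet> gram_schmidt v j) *\<^sub>R enum_basis j)"

lemma measurable_frame_rotation [measurable (raw)]:
  fixes g :: "'b \<Rightarrow> 'a::euclidean_space"
  assumes [measurable]: "f \<in> measurable M frame_measure" "g \<in> borel_measurable M"
  shows "(\<lambda>z. frame_rotation (f z) (g z)) \<in> borel_measurable M"
proof -
  have [measurable]: "(\<lambda>z. gram_schmidt (f z) j) \<in> borel_measurable M" if "j < DIM('a)" for j
    using measurable_compose[OF assms(1) measurable_gram_schmidt[OF that]] .
  show ?thesis unfolding frame_rotation_def by measurable
qed

text \<open>The map \<open>A\<close> from the standard basis to the frame preserves inner products
  because the frame is orthonormal. \<open>frame_rotation v\<close> is its adjoint, hence its
  inverse.\<close>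

lemma orthogonal_transformation_frame_rotation:
  fixes v :: "nat \<Rightarrow> 'a::euclidean_space"
  assumes "\<forall>j<DIM('a). gram_schmidt v j \<noteq> 0"
  shows "orthogonal_transformation (frame_rotation v)"
proof -
  let ?g = "gram_schmidt v" and ?b = "enum_basis :: nat \<Rightarrow> 'a" and ?D = "DIM('a)"
  define A where "A z = (\<Sum>j<?D. (z \<bullet> ?b j) *\<^sub>R ?g j)" for z
  have gg: "?g i \<bullet> ?g j = (if i = j then 1 else 0)" if "i < ?D" "j < ?D" for i j
    using gram_schmidt_orthogonal[of i j v] gram_schmidt_orthogonal[of j i v] that
      norm_gram_schmidt[of v i] assms
    by (cases i j rule: linorder_cases) (auto simp: inner_commute dot_square_norm)
  have AA: "A z \<bullet> A w = z \<bullet> w" for z w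
  proof -
    have "A z \<bullet> A w = (\<Sum>i<?D. \<Sum>j<?D. (z \<bullet> ?b i) * ((w \<bullet> ?b j) * (?g i \<bullet> ?g j)))"
      by (simp only: A_def inner_sum_left inner_sum_right inner_scaleR_left inner_scaleR_right sum_distrib_left)
        (subst sum.swap, simp add: mult.left_commute)
    also have "\<dots> = (\<Sum>i<?D. \<Sum>j<?D. if i = j then (z \<bullet> ?b i) * (w \<bullet> ?b j) else 0)"
      by (intro sum.cong) (auto simp: gg)
    also have "\<dots> = (\<Sum>i<?D. (z \<bullet> ?b i) * (w \<bullet> ?b i))" by simp
    also have "\<dots> = (\<Sum>b\<in>Basis. (z \<bullet> b) * (w \<bullet> b))"
      by (rule sum.reindex_bij_betw[OF bij_betw_enum_basis])
    finally show ?thesis by (simp add: euclidean_inner[of z w])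
  qed
  have "linear A"
    by (intro linearI) (simp_all add: A_def inner_add_left scaleR_add_left sum.distrib scaleR_sum_right)
  with AA have A: "orthogonal_transformation A" by (simp add: orthogonal_transformation_def)
  have "frame_rotation v x \<bullet> z = x \<bullet> A z" for x z
    by (simp add: frame_rotation_def A_def inner_sum_left inner_sum_right inner_commute mult.commute)
  then have "frame_rotation v (A z) = z" for z
    using AA vector_eq_rdot[of "frame_rotation v (A z)" z] by simp
  then have "frame_rotation v = inv A"
    using orthogonal_transformation_bij[OF A] by (metis bij_inv_eq_iff ext)
  then show ?thesis using orthogonal_transformation_inv[OF A] by simp
qed

lemma AE_orthogonal_frame_rotation:
  "AE v in (frame_measure :: (nat \<Rightarrow> 'a::euclidean_space) measure).
    orthogonal_transformation (frame_rotation v)"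
  using AE_gram_schmidt_nonzero by eventually_elim (rule orthogonal_transformation_frame_rotation)

text \<open>Applying \<open>S\<close> to every vector preserves the law of the frame, by the
  invariance of \<open>usphere\<close>, and applies \<open>S\<close> to the orthonormalized vectors.
  So the coordinates of \<open>S x\<close> in the new frame are those of \<open>x\<close> in the old
  one.\<close>

lemma nn_integral_frame_rotation_invariant:
  fixes S :: "'a::euclidean_space \<Rightarrow> 'a" and h :: "'a \<times> 'a \<Rightarrow> ennreal"
  assumes S: "orthogonal_transformation S" and [measurable]: "h \<in> borel_measurable borel"
  shows "(\<integral>\<^sup>+v. h (frame_rotation v (S x), frame_rotation v (S y)) \<partial>frame_measure)
    = (\<integral>\<^sup>+v. h (frame_rotation v x, frame_rotation v y) \<partial>frame_measure)"
proof -
  let ?D = "{..<DIM('a)}" and ?F = "frame_measure :: (nat \<Rightarrow> 'a) measure"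
  have [measurable]: "S \<in> borel_measurable borel" by (rule orthogonal_transformation_measurable[OF S])
  have "distr usphere usphere S = usphere"
    using usphere_distr_orthogonal[OF S] by (simp cong: distr_cong)
  \<comment> \<open>\<open>compose\<close> leaves the frame \<open>undefined\<close> outside the
    index set, as membership in the product space demands.\<close>
  then have eq: "distr ?F ?F (compose ?D S) = ?F"
    unfolding frame_measure_def
    by (subst distr_PiM_finite_prob_space') (auto intro: prob_space_usphere)
  have [measurable]: "compose ?D S \<in> measurable ?F ?F"
    unfolding compose_def frame_measure_def by measurable
  have "frame_rotation (compose ?D S v) (S x) = frame_rotation v x" for v x
  proof -
    have "gram_schmidt (compose ?D S v) j = gram_schmidt (\<lambda>i. S (v i)) j" if "j < DIM('a)" for j
      using that by (intro gram_schmidt_cong) (auto simp: compose_def)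
    then have "S x \<bullet> gram_schmidt (compose ?D S v) j = x \<bullet> gram_schmidt v j" if "j < DIM('a)" for j
      using that S by (simp add: gram_schmidt_orthogonal_transformation orthogonal_transformation_def)
    then show ?thesis by (simp add: frame_rotation_def)
  qed
  note rot = this
  have "(\<integral>\<^sup>+v. h (frame_rotation v (S x), frame_rotation v (S y)) \<partial>distr ?F ?F (compose ?D S))
    = (\<integral>\<^sup>+v. h (frame_rotation v x, frame_rotation v y) \<partial>?F)"
    by (subst nn_integral_distr) (measurable, simp add: rot)
  then show ?thesis by (simp add: eq)
qed

section \<open>Averaging over random rotations\<close>

text \<open>\<open>S\<close> is the reflection in the hyperplane orthogonal to \<open>a - b\<close>.
  If \<open>a = b\<close>, division by zero gives \<open>0\<close> and \<open>S\<close> is the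
  identity.\<close>

lemma reflection_exists:
  fixes a b :: "'a::euclidean_space"
  assumes "norm a = norm b"
  obtains S where "orthogonal_transformation S" "S a = b" "\<And>z. z \<bullet> a = z \<bullet> b \<Longrightarrow> S z = z"
proof
  define d where "d = a - b"
  define S where "S z = z - (2 * (z \<bullet> d) / (d \<bullet> d)) *\<^sub>R d" for z
  have "linear S"
    by (intro linearI) (simp_all add: S_def inner_add_left algebra_simps add_divide_distrib)
  moreover have "S z \<bullet> S w = z \<bullet> w" for z w
    by (cases "d = 0") (simp_all add: S_def inner_diff_left inner_diff_right inner_commute field_simps)
  ultimately show "orthogonal_transformation S" by (simp add: orthogonal_transformation_def)
  have "a \<bullet> a = b \<bullet> b" using assms by (simp add: dot_square_norm)
  then have "2 * (a \<bullet> d) = d \<bullet> d"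
    by (simp add: d_def inner_diff_left inner_diff_right inner_commute)
  then have "S a = a - d" by (cases "d = 0") (simp_all add: S_def)
  then show "S a = b" by (simp add: d_def)
  show "S z = z" if "z \<bullet> a = z \<bullet> b" for z
    using that by (simp add: S_def d_def inner_diff_right)
qed

text \<open>One reflection takes \<open>x\<close> to \<open>x'\<close>; a second one takes the image
  of \<open>y\<close> to \<open>y'\<close> and fixes \<open>x'\<close>, since \<open>x'\<close> has
  the same inner product with both.\<close>

lemma orthogonal_transformation_exists_pair:
  fixes x y x' y' :: "'a::euclidean_space"
  assumes "norm x = norm x'" "norm y = norm y'" "x \<bullet> y = x' \<bullet> y'"
  obtains S where "orthogonal_transformation S" "S x = x'" "S y = y'"
proof -
  obtain S where S: "orthogonal_transformation S" "S x = x'"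
    using reflection_exists[OF assms(1)] by blast
  have "norm (S y) = norm y'"
    using assms(2) orthogonal_transformation_norm[OF S(1)] by simp
  then obtain R where R: "orthogonal_transformation R" "R (S y) = y'"
    "\<And>z. z \<bullet> S y = z \<bullet> y' \<Longrightarrow> R z = z"
    using reflection_exists by blast
  have "x' \<bullet> S y = x \<bullet> y" using S by (auto simp: orthogonal_transformation_def)
  then have "R x' = x'" using R(3) assms(3) by simp
  then show ?thesis
    using that[of "R \<circ> S"] S R orthogonal_transformation_compose[OF R(1) S(1)] by simp
qed

lemma orthogonal_transformation_pair_measurable:
  fixes T :: "'a::euclidean_space \<Rightarrow> 'a"
  assumes "orthogonal_transformation T"
  shows "(\<lambda>z. (T (fst z), T (snd z))) \<in> borel_measurable borel"
proof -
  have [measurable]: "T \<in> borel_measurable borel"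
    by (rule orthogonal_transformation_measurable[OF assms])
  show ?thesis unfolding borel_prod[symmetric] by measurable
qed

text \<open>By Fubini the integral over \<open>N\<close> is taken first, for a fixed frame. Almost
  every frame gives an orthogonal map, under which \<open>N\<close> is invariant, so the inner
  integral is that of \<open>h\<close>.\<close>

lemma nn_integral_frame_average:
  fixes N :: "('a::euclidean_space \<times> 'a) measure" and h :: "'a \<times> 'a \<Rightarrow> ennreal"
  assumes N: "prob_space N" and N_sets: "sets N = sets borel"
    and inv: "\<And>T. orthogonal_transformation T \<Longrightarrow> distr N borel (\<lambda>z. (T (fst z), T (snd z))) = N"
    and h [measurable]: "h \<in> borel_measurable borel"
  shows "(\<integral>\<^sup>+z. \<integral>\<^sup>+v. h (frame_rotation v (fst z), frame_rotation v (snd z)) \<partial>frame_measure \<partial>N)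
    = (\<integral>\<^sup>+z. h z \<partial>N)"
proof -
  interpret N: prob_space N by (rule N)
  interpret pair_sigma_finite N "frame_measure :: (nat \<Rightarrow> 'a) measure" by standard
  have [measurable_cong]: "sets N = sets (borel \<Otimes>\<^sub>M (borel :: 'a measure))"
    by (simp only: N_sets borel_prod)
  have eq: "(\<integral>\<^sup>+z. h (T (fst z), T (snd z)) \<partial>N) = (\<integral>\<^sup>+z. h z \<partial>N)"
    if T: "orthogonal_transformation T" for T
  proof -
    have "(\<integral>\<^sup>+z. h z \<partial>distr N borel (\<lambda>z. (T (fst z), T (snd z)))) = (\<integral>\<^sup>+z. h (T (fst z), T (snd z)) \<partial>N)"
      using orthogonal_transformation_pair_measurable[OF T] h
      by (intro nn_integral_distr) (simp_all cong: measurable_cong_sets add: N_sets borel_prod)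
    then show ?thesis by (simp add: inv[OF T])
  qed
  have "(\<integral>\<^sup>+z. \<integral>\<^sup>+v. h (frame_rotation v (fst z), frame_rotation v (snd z)) \<partial>frame_measure \<partial>N)
    = (\<integral>\<^sup>+v. \<integral>\<^sup>+z. h (frame_rotation v (fst z), frame_rotation v (snd z)) \<partial>N \<partial>frame_measure)"
    by (rule Fubini'[symmetric]) measurable
  also have "\<dots> = (\<integral>\<^sup>+v. \<integral>\<^sup>+z. h z \<partial>N \<partial>(frame_measure :: (nat \<Rightarrow> 'a) measure))"
    by (rule nn_integral_cong_AE) (rule eventually_mono[OF AE_orthogonal_frame_rotation], rule eq)
  also have "\<dots> = (\<integral>\<^sup>+z. h z \<partial>N)" by (simp add: frame.emeasure_space_1)
  finally show ?thesis .
qed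

text \<open>Identifies the law of a randomly rotated pair. Any two pairs of unit vectors with inner
  product \<open>t\<close> are related by an orthogonal map, so the left side has the same value at
  \<open>N\<close>-almost every pair, and its average over \<open>N\<close> is the integral of
  \<open>h\<close>.\<close>

lemma nn_integral_frame_pair:
  fixes N :: "('a::euclidean_space \<times> 'a) measure" and h :: "'a \<times> 'a \<Rightarrow> ennreal"
  assumes N: "prob_space N" and N_sets: "sets N = sets borel"
    and inv: "\<And>T. orthogonal_transformation T \<Longrightarrow> distr N borel (\<lambda>z. (T (fst z), T (snd z))) = N"
    and h: "h \<in> borel_measurable borel"
    and AE: "AE z in N. norm (fst z) = 1 \<and> norm (snd z) = 1 \<and> fst z \<bullet> snd z = t"
    and xy: "norm x = 1" "norm y = 1" "x \<bullet> y = t"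
  shows "(\<integral>\<^sup>+v. h (frame_rotation v x, frame_rotation v y) \<partial>frame_measure) = (\<integral>\<^sup>+z. h z \<partial>N)"
proof -
  interpret N: prob_space N by (rule N)
  let ?c = "\<integral>\<^sup>+v. h (frame_rotation v x, frame_rotation v y) \<partial>frame_measure"
  have c: "(\<integral>\<^sup>+v. h (frame_rotation v (fst z), frame_rotation v (snd z)) \<partial>frame_measure) = ?c"
    if z: "norm (fst z) = 1 \<and> norm (snd z) = 1 \<and> fst z \<bullet> snd z = t" for z
  proof -
    obtain S where "orthogonal_transformation S" "S x = fst z" "S y = snd z"
      using orthogonal_transformation_exists_pair[of x "fst z" y "snd z"] z xy by auto
    then show ?thesis using nn_integral_frame_rotation_invariant[of S h x y] h by simp
  qed
  have "(\<integral>\<^sup>+z. h z \<partial>N)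
    = (\<integral>\<^sup>+z. \<integral>\<^sup>+v. h (frame_rotation v (fst z), frame_rotation v (snd z)) \<partial>frame_measure \<partial>N)"
    by (rule nn_integral_frame_average[OF N N_sets inv h, symmetric])
  also have "\<dots> = (\<integral>\<^sup>+z. ?c \<partial>N)"
    by (rule nn_integral_cong_AE) (rule eventually_mono[OF AE], rule c)
  also have "\<dots> = ?c" by (simp add: N.emeasure_space_1)
  finally show ?thesis by simp
qed

lemma nn_integral_frame_single:
  fixes M :: "'a::euclidean_space measure"
  assumes M: "prob_space M" and M_sets [measurable_cong]: "sets M = sets borel"
    and inv: "\<And>T. orthogonal_transformation T \<Longrightarrow> distr M borel T = M"
    and AE: "AE x in M. norm x = 1"
    and A [measurable]: "A \<in> sets borel" and x: "norm x = 1"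
  shows "(\<integral>\<^sup>+v. indicator A (frame_rotation v x) \<partial>frame_measure) = emeasure M A"
proof -
  \<comment> \<open>Placing \<open>M\<close> on the diagonal turns a single point into a pair with
    inner product \<open>1\<close>.\<close>
  let ?N = "distr M borel (\<lambda>x. (x, x))"
  have h [measurable]: "(\<lambda>z. indicator A (fst z) :: ennreal) \<in> borel_measurable (borel :: ('a \<times> 'a) measure)"
    unfolding borel_prod[symmetric] by measurable
  have "(\<integral>\<^sup>+v. indicator A (frame_rotation v x) \<partial>frame_measure) = (\<integral>\<^sup>+z. indicator A (fst z) \<partial>?N)"
  proof (rule nn_integral_frame_pair[where h = "\<lambda>z. indicator A (fst z)" and t = 1 and y = x,
        unfolded fst_conv])
    show "prob_space ?N" using M by (rule prob_space.prob_space_distr) measurable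
    show "distr ?N borel (\<lambda>z. (T (fst z), T (snd z))) = ?N" if T: "orthogonal_transformation T" for T
    proof -
      have [measurable]: "T \<in> borel_measurable borel"
        by (rule orthogonal_transformation_measurable[OF T])
      note [measurable] = orthogonal_transformation_pair_measurable[OF T]
      have "distr ?N borel (\<lambda>z. (T (fst z), T (snd z))) = distr M borel (\<lambda>x. (T x, T x))"
        by (subst distr_distr) (auto simp: o_def)
      also have "\<dots> = distr (distr M borel T) borel (\<lambda>x. (x, x))"
        by (subst distr_distr) (auto simp: o_def)
      finally show ?thesis by (simp add: inv[OF T])
    qed
    show "AE z in ?N. norm (fst z) = 1 \<and> norm (snd z) = 1 \<and> fst z \<bullet> snd z = 1"
    proof (subst AE_distr_iff)
      have "closed {z :: 'a \<times> 'a. norm (fst z) = 1 \<and> norm (snd z) = 1 \<and> fst z \<bullet> snd z = 1}"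
        by (intro closed_Collect_conj closed_Collect_eq continuous_intros)
      then show "{z \<in> space borel. norm (fst z) = 1 \<and> norm (snd z) = 1 \<and> fst z \<bullet> snd z = 1}
        \<in> sets (borel :: ('a \<times> 'a) measure)" by simp
    qed (use AE in \<open>auto simp: dot_square_norm elim: eventually_mono\<close>)
  qed (use x h in \<open>auto simp: dot_square_norm\<close>)
  also have "\<dots> = emeasure M A" by (subst nn_integral_distr) auto
  finally show ?thesis .
qed

text \<open>Uniqueness of the invariant probability measure: both measures are the law of the random
  rotation of one fixed unit vector.\<close>

lemma invariant_measure_eq_usphere:
  fixes M :: "'a::euclidean_space measure"
  assumes "prob_space M" and sets: "sets M = sets borel"
    and "\<And>T. orthogonal_transformation T \<Longrightarrow> distr M borel T = M"
    and "AE x in M. norm x = 1"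
  shows "M = usphere"
proof (rule measure_eqI)
  fix A assume "A \<in> sets M"
  then have A: "A \<in> sets borel" using sets by simp
  obtain x :: 'a where x: "norm x = 1" using vector_choose_size[of 1] by auto
  show "emeasure M A = emeasure usphere A"
    using nn_integral_frame_single[OF assms A x]
      nn_integral_frame_single[OF prob_space_usphere sets_usphere usphere_distr_orthogonal AE_usphere_norm A x]
    by simp
qed (simp add: sets)

section \<open>The autocorrelation kernel of a Borel set\<close>

definition frame_kernel :: "'a::euclidean_space set \<Rightarrow> 'a \<Rightarrow> 'a \<Rightarrow> real" where
  "frame_kernel I x y
    = (LINT v|frame_measure. indicator I (frame_rotation v x) * indicator I (frame_rotation v y))"

lemma ennreal_frame_kernel:
  fixes I :: "'a::euclidean_space set"
  assumes [measurable]: "I \<in> sets borel"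
  shows "ennreal (frame_kernel I x y)
    = (\<integral>\<^sup>+v. indicator (I \<times> I) (frame_rotation v x, frame_rotation v y) \<partial>frame_measure)"
proof -
  have "(\<integral>\<^sup>+v. indicator (I \<times> I) (frame_rotation v x, frame_rotation v y) \<partial>frame_measure)
    = (\<integral>\<^sup>+v. ennreal (indicator I (frame_rotation v x) * indicator I (frame_rotation v y)) \<partial>frame_measure)"
    by (rule nn_integral_cong) (simp add: indicator_def)
  also have "\<dots> = ennreal (frame_kernel I x y)"
    unfolding frame_kernel_def
    by (rule nn_integral_eq_integral)
      (auto intro!: frame.integrable_const_bound[where B = 1] simp: indicator_def)
  finally show ?thesis by simp
qed

lemma integrable_frame_kernel:
  fixes I :: "'a::euclidean_space set"
  assumes [measurable]: "I \<in> sets borel"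
  shows "integrable frame_measure
    (\<lambda>v. indicator I (frame_rotation v x) * indicator I (frame_rotation v y) :: real)"
  by (auto intro!: frame.integrable_const_bound[where B = 1] simp: indicator_def)

lemma frame_kernel_nonneg: "frame_kernel I x y \<ge> 0"
  unfolding frame_kernel_def by (rule integral_nonneg_AE) simp

lemma frame_kernel_invariant:
  fixes I :: "'a::euclidean_space set"
  assumes I [measurable]: "I \<in> sets borel"
    and "norm x = norm x'" "norm y = norm y'" "x \<bullet> y = x' \<bullet> y'"
  shows "frame_kernel I x y = frame_kernel I x' y'"
proof -
  obtain S where S: "orthogonal_transformation S" "S x = x'" "S y = y'"
    using orthogonal_transformation_exists_pair assms(2-) by blast
  have "I \<times> I \<in> sets borel" by (simp add: borel_Times I)
  then have "ennreal (frame_kernel I x y) = ennreal (frame_kernel I x' y')"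
    using nn_integral_frame_rotation_invariant[OF S(1), of "indicator (I \<times> I)" x y] S
    by (simp add: ennreal_frame_kernel)
  then show ?thesis by (simp add: frame_kernel_nonneg)
qed

lemma frame_kernel_diag:
  fixes I :: "'a::euclidean_space set"
  assumes [measurable]: "I \<in> sets borel" and x: "norm x = 1"
  shows "frame_kernel I x x = measure usphere I"
proof -
  have "ennreal (frame_kernel I x x) = emeasure usphere I"
    unfolding ennreal_frame_kernel[OF assms(1)]
    using nn_integral_frame_single[OF prob_space_usphere sets_usphere usphere_distr_orthogonal
        AE_usphere_norm assms(1) x]
    by (simp add: indicator_def)
  then show ?thesis by (simp add: usphere.emeasure_eq_measure frame_kernel_nonneg)
qed

text \<open>The quadratic form is the expected square of the sum of \<open>c x\<close> over those
  \<open>x\<close> in \<open>U\<close> that are rotated into \<open>I\<close>.\<close>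

lemma frame_kernel_psd:
  fixes I :: "'a::euclidean_space set"
  assumes [measurable]: "I \<in> sets borel" and "finite U"
  shows "0 \<le> (\<Sum>x\<in>U. \<Sum>y\<in>U. c x * frame_kernel I x y * c y)"
proof -
  let ?i = "\<lambda>v x. indicator I (frame_rotation v x) :: real"
  have "(\<Sum>x\<in>U. \<Sum>y\<in>U. c x * frame_kernel I x y * c y)
    = (\<Sum>x\<in>U. \<Sum>y\<in>U. LINT v|frame_measure. c x * (?i v x * ?i v y) * c y)"
    by (simp add: frame_kernel_def)
  also have "\<dots> = (LINT v|frame_measure. (\<Sum>x\<in>U. \<Sum>y\<in>U. c x * (?i v x * ?i v y) * c y))"
    by (simp add: Bochner_Integration.integral_sum integrable_frame_kernel)
  also have "\<dots> = (LINT v|frame_measure. (\<Sum>x\<in>U. c x * ?i v x)\<^sup>2)"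
    by (simp add: power2_eq_square sum_product mult_ac)
  finally show ?thesis by simp
qed

text \<open>Regularity gives a compact \<open>K\<close> inside \<open>I\<close> and an open
  \<open>U\<close> around \<open>I\<close> with \<open>U - K\<close> of measure below
  \<open>e\<close>. A Urysohn function that is \<open>1\<close> on \<open>K\<close> and
  \<open>0\<close> off \<open>U\<close> differs from the indicator at most on
  \<open>D = U - K\<close>.\<close>

lemma continuous_approximation_indicator:
  fixes M :: "'a::euclidean_space measure"
  assumes "prob_space M" and sets: "sets M = sets borel" and I: "I \<in> sets borel" and e: "0 < (e::real)"
  obtains g :: "'a \<Rightarrow> real" and D where "continuous_on UNIV g" "\<And>x. 0 \<le> g x" "\<And>x. g x \<le> 1"
    "D \<in> sets borel" "measure M D < e" "\<And>x. \<bar>indicator I x - g x\<bar> \<le> indicator D x"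
proof -
  interpret prob_space M by fact
  have fin: "emeasure M (space M) \<noteq> \<infinity>" by simp
  obtain K where K: "K \<subseteq> I" "compact K" "measure M I < measure M K + e / 2"
  \<comment> \<open>The case distinction keeps \<open>measure M I - e / 2\<close> nonnegative, since
    \<open>ennreal\<close> sends negative numbers to \<open>0\<close>.\<close>
  proof (cases "measure M I < e / 2")
    case True
    then show ?thesis by (intro that[of "{}"]) auto
  next
    case False
    then have "ennreal (measure M I - e / 2) < emeasure M I"
      using e by (simp add: emeasure_eq_measure ennreal_less_iff)
    then have "ennreal (measure M I - e / 2) < (SUP K \<in> {K. K \<subseteq> I \<and> compact K}. emeasure M K)"
      by (simp add: inner_regular[OF sets fin I])
    then obtain K where K: "K \<subseteq> I" "compact K" "ennreal (measure M I - e / 2) < emeasure M K"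
      by (auto simp: less_SUP_iff)
    have "measure M I - e / 2 < measure M K"
      using K(3) False by (simp add: emeasure_eq_measure ennreal_less_iff)
    then show ?thesis using K by (intro that[of K]) auto
  qed
  have "emeasure M I < ennreal (measure M I + e / 2)"
    using e by (simp add: emeasure_eq_measure ennreal_less_iff)
  then have "(INF U \<in> {U. I \<subseteq> U \<and> open U}. emeasure M U) < ennreal (measure M I + e / 2)"
    by (simp add: outer_regular[OF sets fin I])
  then obtain U where U: "I \<subseteq> U" "open U" "emeasure M U < ennreal (measure M I + e / 2)"
    by (auto simp: INF_less_iff)
  then have U3: "measure M U < measure M I + e / 2"
    using e by (simp add: emeasure_eq_measure ennreal_less_iff del: ennreal_plus)
  obtain g :: "'a \<Rightarrow> real" where g: "continuous_on UNIV g" "\<And>x. g x \<in> closed_segment 1 0"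
    "\<And>x. x \<in> K \<Longrightarrow> g x = 1" "\<And>x. x \<in> - U \<Longrightarrow> g x = 0"
  proof (rule Urysohn[of K "- U" 1 "0::real"])
    show "closed K" "closed (- U)" "K \<inter> - U = {}"
      using K U by (auto intro: compact_imp_closed)
  qed blast
  have g01: "0 \<le> g x" "g x \<le> 1" for x using g(2)[of x] by (auto simp: closed_segment_eq_real_ivl)
  have KU: "K \<in> events" "U \<in> events" using K U sets by (auto intro: borel_compact)
  have "measure M (U - K) = measure M U - measure M K"
    using KU K U by (intro finite_measure_Diff) auto
  then have "measure M (U - K) < e" using K(3) U3 by simp
  moreover have "\<bar>indicator I x - g x\<bar> \<le> indicator (U - K) x" for x
    using K(1) U(1) g(3,4)[of x] g01[of x] by (cases "x \<in> K"; cases "x \<in> U"; cases "x \<in> I") auto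
  ultimately show ?thesis using that[of g "U - K"] g g01 KU sets by auto
qed

lemma frame_rotation_continuous: "continuous_on UNIV (frame_rotation v)"
  unfolding frame_rotation_def by (intro continuous_intros)

text \<open>Replacing the indicator at \<open>y\<close> by a continuous \<open>g\<close> costs at
  most the measure of \<open>D\<close>, uniformly in \<open>y\<close>, because the rotated
  \<open>y\<close> is uniformly distributed. The resulting function \<open>kg\<close> is continuous
  by dominated convergence.\<close>

lemma frame_kernel_continuous:
  fixes I :: "'a::euclidean_space set"
  assumes I [measurable]: "I \<in> sets borel"
  shows "continuous_on (sphere 0 1) (frame_kernel I x)"
  unfolding continuous_on_iff
proof (intro ballI allI impI)
  fix y0 :: 'a and e :: real
  assume y0: "y0 \<in> sphere 0 1" and e: "e > 0"
  obtain g :: "'a \<Rightarrow> real" and D where g: "continuous_on UNIV g" and g01: "\<And>x. 0 \<le> g x" "\<And>x. g x \<le> 1"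
    and D [measurable]: "D \<in> sets borel" and De: "measure usphere D < e / 3"
    and gD: "\<And>x. \<bar>indicator I x - g x\<bar> \<le> indicator D x"
    using continuous_approximation_indicator[OF prob_space_usphere sets_usphere I, of "e / 3"] e by auto
  have [measurable]: "g \<in> borel_measurable borel" using g by (rule borel_measurable_continuous_onI)
  let ?i = "\<lambda>v. indicator I (frame_rotation v x) :: real"
  define kg where "kg y = (LINT v|frame_measure. ?i v * g (frame_rotation v y))" for y
  have int: "integrable frame_measure (\<lambda>v. ?i v * g (frame_rotation v y))" for y
    by (rule frame.integrable_const_bound[where B = 1]) (auto simp: indicator_def g01)
  have close: "\<bar>frame_kernel I x y - kg y\<bar> < e / 3" if y: "y \<in> sphere 0 1" for y
  proof -
    have "\<bar>frame_kernel I x y - kg y\<bar>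
      = \<bar>LINT v|frame_measure. ?i v * indicator I (frame_rotation v y) - ?i v * g (frame_rotation v y)\<bar>"
      unfolding frame_kernel_def kg_def
      by (subst Bochner_Integration.integral_diff) (auto intro: integrable_frame_kernel int)
    also have "\<dots> \<le> (LINT v|frame_measure. \<bar>?i v * indicator I (frame_rotation v y) - ?i v * g (frame_rotation v y)\<bar>)"
      by (rule integral_abs_bound)
    \<comment> \<open>The bound is written as a product so that its integral is
      \<open>frame_kernel D y y\<close>.\<close>
    also have "\<dots> \<le> (LINT v|frame_measure. indicator D (frame_rotation v y) * indicator D (frame_rotation v y))"
    proof (rule integral_mono)
      show "\<bar>?i v * indicator I (frame_rotation v y) - ?i v * g (frame_rotation v y)\<bar>
        \<le> indicator D (frame_rotation v y) * indicator D (frame_rotation v y)" for v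
        using gD[of "frame_rotation v y"] by (auto simp: indicator_def split: if_splits)
    qed (auto intro!: integrable_abs Bochner_Integration.integrable_diff integrable_frame_kernel int)
    also have "\<dots> = measure usphere D"
      using frame_kernel_diag[OF D, of y] y by (simp add: frame_kernel_def)
    finally show ?thesis using De by simp
  qed
  have "continuous_on (sphere 0 1) kg"
    unfolding continuous_on_sequentially comp_def
  proof (intro allI ballI impI, elim conjE)
    fix Y :: "nat \<Rightarrow> 'a" and y assume Y: "Y \<longlonglongrightarrow> y"
    show "(\<lambda>n. kg (Y n)) \<longlonglongrightarrow> kg y"
      unfolding kg_def
    proof (rule integral_dominated_convergence[where w = "\<lambda>_. 1"])
      have "isCont (\<lambda>y. g (frame_rotation v y)) y" for v
        using continuous_on_compose2[OF g frame_rotation_continuous[of v]]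
        by (simp add: continuous_on_eq_continuous_at)
      then have "(\<lambda>n. g (frame_rotation v (Y n))) \<longlonglongrightarrow> g (frame_rotation v y)" for v
        using isCont_tendsto_compose Y by fast
      then show "AE v in frame_measure. (\<lambda>n. ?i v * g (frame_rotation v (Y n))) \<longlonglongrightarrow> ?i v * g (frame_rotation v y)"
        by (intro AE_I2 tendsto_mult_left)
    qed (auto simp: indicator_def g01)
  qed
  then obtain d where d: "d > 0"
    "\<And>y. y \<in> sphere 0 1 \<Longrightarrow> dist y y0 < d \<Longrightarrow> dist (kg y) (kg y0) < e / 3"
    using \<open>continuous_on (sphere 0 1) kg\<close>[unfolded continuous_on_iff, rule_format, OF y0, of "e / 3"] e
    by auto
  have "dist (frame_kernel I x y) (frame_kernel I x y0) < e" if "y \<in> sphere 0 1" "dist y y0 < d" for y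
    using close[OF that(1)] close[OF y0] d(2)[OF that] unfolding dist_real_def by linarith
  then show "\<exists>d>0. \<forall>y\<in>sphere 0 1. dist y y0 < d \<longrightarrow> dist (frame_kernel I x y) (frame_kernel I x y0) < e"
    using d(1) by blast
qed

section \<open>The double integral of the kernel\<close>

lemma usphere_pair_invariant:
  fixes T :: "'a::euclidean_space \<Rightarrow> 'a"
  assumes T: "orthogonal_transformation T"
  shows "distr (usphere \<Otimes>\<^sub>M usphere) borel (\<lambda>z. (T (fst z), T (snd z))) = usphere \<Otimes>\<^sub>M usphere"
proof -
  have [measurable]: "T \<in> borel_measurable borel" by (rule orthogonal_transformation_measurable[OF T])
  have "usphere \<Otimes>\<^sub>M usphere = distr usphere borel T \<Otimes>\<^sub>M distr usphere borel T"
    by (simp add: usphere_distr_orthogonal[OF T])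
  also have "\<dots> = distr (usphere \<Otimes>\<^sub>M usphere) (borel \<Otimes>\<^sub>M borel) (\<lambda>(x, y). (T x, T y))"
    by (rule pair_measure_distr)
      (auto simp: usphere_distr_orthogonal[OF T] usphere.sigma_finite_measure_axioms)
  also have "\<dots> = distr (usphere \<Otimes>\<^sub>M usphere) borel (\<lambda>z. (T (fst z), T (snd z)))"
    by (simp add: borel_prod split_beta')
  finally show ?thesis by (rule sym)
qed

lemma prob_space_usphere_pair:
  "prob_space (usphere \<Otimes>\<^sub>M usphere :: ('a::euclidean_space \<times> 'a) measure)"
  by (intro prob_space_pair prob_space_usphere)

lemma sets_usphere_pair: "sets (usphere \<Otimes>\<^sub>M usphere :: ('a::euclidean_space \<times> 'a) measure) = sets borel"
proof -
  have "sets (usphere \<Otimes>\<^sub>M usphere :: ('a \<times> 'a) measure) = sets ((borel :: 'a measure) \<Otimes>\<^sub>M (borel :: 'a measure))"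
    by (intro sets_pair_measure_cong) auto
  then show ?thesis by (simp only: borel_prod)
qed

text \<open>Two independent uniform points have an invariant joint law, so averaging over rotations
  does not change the probability that both lie in \<open>I\<close>.\<close>

lemma nn_integral_frame_kernel:
  fixes I :: "'a::euclidean_space set"
  assumes I [measurable]: "I \<in> sets borel"
  shows "(\<integral>\<^sup>+x. \<integral>\<^sup>+y. ennreal (frame_kernel I x y) \<partial>usphere \<partial>usphere) = (emeasure usphere I)\<^sup>2"
proof -
  interpret pair_sigma_finite "usphere :: 'a measure" "usphere :: 'a measure" by standard
  have II [measurable]: "I \<times> I \<in> sets borel" by (simp add: borel_Times)
  have "(\<integral>\<^sup>+x. \<integral>\<^sup>+y. ennreal (frame_kernel I x y) \<partial>usphere \<partial>usphere)
    = (\<integral>\<^sup>+z. ennreal (frame_kernel I (fst z) (snd z)) \<partial>(usphere \<Otimes>\<^sub>M usphere))"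
    by (subst usphere.nn_integral_fst[symmetric]) (auto simp: frame_kernel_def)
  also have "\<dots> = (\<integral>\<^sup>+z. indicator (I \<times> I) z \<partial>(usphere \<Otimes>\<^sub>M usphere))"
    unfolding ennreal_frame_kernel[OF I]
    by (rule nn_integral_frame_average[OF prob_space_usphere_pair sets_usphere_pair usphere_pair_invariant]) auto
  also have "\<dots> = emeasure (usphere \<Otimes>\<^sub>M usphere) (I \<times> I)"
    by (rule nn_integral_indicator) simp
  also have "\<dots> = (emeasure usphere I)\<^sup>2"
    by (simp add: usphere.emeasure_pair_measure_Times power2_eq_square)
  finally show ?thesis .
qed

section \<open>Sections of the sphere\<close>

text \<open>The kernel at \<open>(x, y)\<close> is the probability of \<open>I \<times> I\<close>
  under any invariant law on pairs with inner product \<open>t\<close>. Such a law is built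
  explicitly from two independent uniform points, and the second point is integrated first.\<close>

lemma frame_kernel_section_bound:
  fixes I :: "'a::euclidean_space set"
  assumes dim: "DIM('a) \<ge> 2" and I [measurable]: "I \<in> sets borel"
    and t: "-1 < t" "t < 1" and xy: "norm x = 1" "norm y = 1" "x \<bullet> y = t" and a: "a \<ge> 0"
    and bound: "\<And>p. p \<in> I \<Longrightarrow> emeasure usphere
      {z. t *\<^sub>R p + sqrt (1 - t\<^sup>2) *\<^sub>R sgn (z - (z \<bullet> p) *\<^sub>R p) \<in> I} \<le> ennreal a"
  shows "frame_kernel I x y \<le> a * measure usphere I"
proof -
  interpret pair_sigma_finite "usphere :: 'a measure" "usphere :: 'a measure" by standard
  let ?s = "sqrt (1 - t\<^sup>2)"
  have t2: "t\<^sup>2 \<le> 1" using t by (simp add: abs_square_le_1)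
  \<comment> \<open>The second point is projected to the hyperplane orthogonal to the first one,
    normalized, and lifted to height \<open>t\<close>.\<close>
  define q where "q z = t *\<^sub>R fst z + ?s *\<^sub>R sgn (snd z - (snd z \<bullet> fst z) *\<^sub>R fst z)" for z :: "'a \<times> 'a"
  let ?W2 = "usphere \<Otimes>\<^sub>M usphere :: ('a \<times> 'a) measure"
  have q_m [measurable]: "q \<in> borel_measurable (borel \<Otimes>\<^sub>M borel)"
    unfolding q_def by measurable
  then have fq [measurable]: "(\<lambda>z. (fst z, q z)) \<in> borel_measurable (borel :: ('a \<times> 'a) measure)"
    unfolding borel_prod[symmetric] by measurable
  then have fq2 [measurable]: "(\<lambda>z. (fst z, q z)) \<in> borel_measurable ?W2"
    by (simp only: measurable_cong_sets[OF sets_usphere_pair refl])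
  have [measurable]: "q \<in> borel_measurable ?W2"
    using q_m by (simp only: measurable_cong_sets[OF sets_usphere_pair refl] borel_prod)
  let ?N = "distr ?W2 borel (\<lambda>z. (fst z, q z))"
  have II [measurable]: "I \<times> I \<in> sets borel" by (simp add: borel_Times)
  have "ennreal (frame_kernel I x y) = (\<integral>\<^sup>+z. indicator (I \<times> I) z \<partial>?N)"
    unfolding ennreal_frame_kernel[OF I]
  proof (rule nn_integral_frame_pair[OF _ _ _ _ _ xy])
    show "prob_space ?N" by (rule prob_space.prob_space_distr[OF prob_space_usphere_pair fq2])
    show "distr ?N borel (\<lambda>z. (T (fst z), T (snd z))) = ?N" if T: "orthogonal_transformation T" for T
    proof -
      note [measurable] = orthogonal_transformation_pair_measurable[OF T]
      have TW: "(\<lambda>z. (T (fst z), T (snd z))) \<in> borel_measurable ?W2"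
        using orthogonal_transformation_pair_measurable[OF T]
        by (simp only: measurable_cong_sets[OF sets_usphere_pair refl])
      have lin: "linear T" using T by (rule orthogonal_transformation_linear)
      \<comment> \<open>The construction commutes with orthogonal maps, so \<open>?N\<close>
        inherits the invariance of the product measure.\<close>
      have "T (q z) = q (T (fst z), T (snd z))" for z
        using T
        by (simp add: q_def linear_add[OF lin] linear_cmul[OF lin] linear_diff[OF lin]
            sgn_orthogonal[OF T, symmetric] orthogonal_transformation_def)
      then have "distr ?N borel (\<lambda>z. (T (fst z), T (snd z)))
        = distr ?W2 borel ((\<lambda>z. (fst z, q z)) \<circ> (\<lambda>z. (T (fst z), T (snd z))))"
        by (subst distr_distr) (auto simp: o_def)
      also have "\<dots> = distr (distr ?W2 borel (\<lambda>z. (T (fst z), T (snd z)))) borel (\<lambda>z. (fst z, q z))"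
        using TW by (subst distr_distr) auto
      finally show ?thesis by (simp add: usphere_pair_invariant[OF T])
    qed
    show "AE z in ?N. norm (fst z) = 1 \<and> norm (snd z) = 1 \<and> fst z \<bullet> snd z = t"
    proof (subst AE_distr_iff)
      have "closed {z :: 'a \<times> 'a. norm (fst z) = 1 \<and> norm (snd z) = 1 \<and> fst z \<bullet> snd z = t}"
        by (intro closed_Collect_conj closed_Collect_eq continuous_intros)
      then show "{z \<in> space borel. norm (fst z) = 1 \<and> norm (snd z) = 1 \<and> fst z \<bullet> snd z = t}
        \<in> sets (borel :: ('a \<times> 'a) measure)" by simp
      have "AE x in usphere. AE y in usphere. norm x = 1 \<and> norm (q (x, y)) = 1 \<and> x \<bullet> q (x, y) = t"
        using AE_usphere_norm
      proof eventually_elim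
        fix x :: 'a assume x: "norm x = 1"
        \<comment> \<open>Off the line through \<open>x\<close> the projection is nonzero and can be
          normalized; the line is null since the dimension is at least two.\<close>
        have "dim (span {x}) \<le> card {x}" by (simp add: dim_le_card')
        then have "AE y in usphere. y \<notin> span {x}"
          using dim by (intro AE_usphere_notin_subspace) auto
        then show "AE y in usphere. norm x = 1 \<and> norm (q (x, y)) = 1 \<and> x \<bullet> q (x, y) = t"
        proof eventually_elim
          fix y assume y: "y \<notin> span {x}"
          let ?w = "y - (y \<bullet> x) *\<^sub>R x"
          have xx: "x \<bullet> x = 1" using x by (simp add: dot_square_norm)
          have "?w \<noteq> 0" using y by (metis eq_iff_diff_eq_0 insertI1 span_base span_scale)
          then have ww: "sgn ?w \<bullet> sgn ?w = 1" by (simp add: dot_square_norm norm_sgn)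
          have xw: "x \<bullet> sgn ?w = 0"
            by (simp add: sgn_div_norm inner_diff_right xx inner_commute)
          have "q (x, y) \<bullet> q (x, y) = t\<^sup>2 + ?s * ?s"
            using xx ww xw
            by (simp add: q_def inner_add_left inner_add_right inner_commute power2_eq_square)
          also have "\<dots> = 1" using t2 by simp
          finally have "norm (q (x, y)) = 1" by (simp add: norm_eq_sqrt_inner)
          moreover have "x \<bullet> q (x, y) = t" using xx xw by (simp add: q_def inner_add_right)
          ultimately show "norm x = 1 \<and> norm (q (x, y)) = 1 \<and> x \<bullet> q (x, y) = t" using x by simp
        qed
      qed
      then have "AE x in usphere. AE y in usphere. norm (fst (x, y)) = 1 \<and> norm (q (x, y)) = 1
          \<and> fst (x, y) \<bullet> q (x, y) = t" by (simp only: fst_conv)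
      moreover have "{z \<in> space ?W2. norm (fst z) = 1 \<and> norm (q z) = 1 \<and> fst z \<bullet> q z = t} \<in> sets ?W2"
        by measurable
      ultimately have "AE z in ?W2. norm (fst z) = 1 \<and> norm (q z) = 1 \<and> fst z \<bullet> q z = t"
        by (rule AE_pair_measure[rotated])
      then show "AE z in ?W2. norm (fst (fst z, q z)) = 1 \<and> norm (snd (fst z, q z)) = 1
          \<and> fst (fst z, q z) \<bullet> snd (fst z, q z) = t" by simp
    qed (rule fq2)
  qed auto
  also have "\<dots> = (\<integral>\<^sup>+z. indicator I (fst z) * indicator I (q z) \<partial>?W2)"
    by (subst nn_integral_distr) (auto intro!: nn_integral_cong simp: indicator_def)
  also have "\<dots> = (\<integral>\<^sup>+p. \<integral>\<^sup>+z. indicator I p * indicator I (q (p, z)) \<partial>usphere \<partial>usphere)"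
    by (subst usphere.nn_integral_fst[symmetric]) auto
  also have "\<dots> \<le> (\<integral>\<^sup>+p. ennreal a * indicator I p \<partial>usphere)"
  proof (rule nn_integral_mono)
    fix p :: 'a
    have qp: "(\<lambda>z. q (p, z)) \<in> borel_measurable borel" by measurable
    have m: "{z. q (p, z) \<in> I} \<in> sets borel"
      using measurable_sets[OF qp I] by (simp add: vimage_def)
    have "(\<integral>\<^sup>+z. indicator I (q (p, z)) \<partial>usphere) = (\<integral>\<^sup>+z. indicator {z. q (p, z) \<in> I} z \<partial>usphere)"
      by (rule nn_integral_cong) (simp add: indicator_def)
    also have "\<dots> = emeasure usphere {z. q (p, z) \<in> I}"
      using m by (intro nn_integral_indicator) simp
    finally show "(\<integral>\<^sup>+z. indicator I p * indicator I (q (p, z)) \<partial>usphere) \<le> ennreal a * indicator I p"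
      using bound[of p] by (cases "p \<in> I") (auto simp: q_def)
  qed
  also have "\<dots> = ennreal (a * measure usphere I)"
    using a by (subst nn_integral_cmult_indicator)
      (auto simp: usphere.emeasure_eq_measure ennreal_mult)
  finally show ?thesis using a by simp
qed

lemma isometry_onto_hyperplane_exists:
  fixes p :: "'a::euclidean_space"
  assumes "p \<noteq> 0" and dim: "DIM('a) = Suc DIM('b::euclidean_space)"
  obtains L :: "'b::euclidean_space \<Rightarrow> 'a" where "linear L" "\<And>w. norm (L w) = norm w" "\<And>w. p \<bullet> L w = 0"
proof -
  have "dim (UNIV :: 'b set) \<le> dim {z. p \<bullet> z = 0}"
    using dim_hyperplane[OF assms(1)] dim by simp
  then obtain L :: "'b \<Rightarrow> 'a" where "linear L" "L \<in> UNIV \<rightarrow> {z. p \<bullet> z = 0}"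
    "\<And>w. w \<in> UNIV \<Longrightarrow> norm (L w) = norm w"
    using isometry_subset_subspace[OF subspace_UNIV subspace_hyperplane] by blast
  then show ?thesis by (intro that[of L]) auto
qed

text \<open>In the coordinates given by \<open>L\<close>, the normalized projection of a uniform
  point is \<open>sgn (G z)\<close> with \<open>G\<close> the adjoint of \<open>L\<close>. Its law
  is invariant under orthogonal maps of the smaller space, hence uniform.\<close>

lemma emeasure_usphere_section:
  fixes p :: "'a::euclidean_space" and L :: "'b::euclidean_space \<Rightarrow> 'a"
  assumes p: "norm p = 1" and dim: "DIM('a) = Suc DIM('b)"
    and lin: "linear L" and iso: "\<And>w. norm (L w) = norm w" and Lp: "\<And>w. p \<bullet> L w = 0"
    and A [measurable]: "A \<in> sets borel"
  shows "emeasure usphere {z. sgn (z - (z \<bullet> p) *\<^sub>R p) \<in> A} = emeasure usphere {w. L w \<in> A}"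
proof -
  have inner_L: "L v \<bullet> L w = v \<bullet> w" for v w
    using iso[of "v + w"] iso[of v] iso[of w]
    by (simp add: linear_add[OF lin] dot_norm)
  have pp: "p \<bullet> p = 1" using p by (simp add: dot_square_norm)
  have p0: "p \<noteq> 0" using p by auto
  define G where "G = adjoint L"
  have G: "G z \<bullet> w = z \<bullet> L w" for z w
    unfolding G_def using adjoint_works[OF lin, of w z] by (simp add: inner_commute)
  have lG: "linear G" unfolding G_def by (rule adjoint_linear[OF lin])
  have GL: "G (L w) = w" for w
    using vector_eq_rdot[of "G (L w)" w] by (simp add: G inner_L)
  have Gp: "G p = 0"
    using vector_eq_rdot[of "G p" 0] by (simp add: G Lp)
  \<comment> \<open>Equality of dimensions makes \<open>L\<close> onto the hyperplane, so
    \<open>L \<circ> G\<close> is the orthogonal projection along \<open>p\<close>.\<close>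
  have "range L = {z. p \<bullet> z = 0}"
  proof (rule subspace_dim_equal)
    show "subspace (range L)" using lin by (simp add: linear_subspace_image subspace_UNIV)
    show "subspace {z. p \<bullet> z = 0}" by (rule subspace_hyperplane)
    show "range L \<subseteq> {z. p \<bullet> z = 0}" using Lp by auto
    have "inj L" using iso by (simp add: linear_injective_0[OF lin]) (metis norm_eq_zero)
    then have "dim (range L) = DIM('b)" using dim_image_eq[OF lin, of UNIV] by simp
    then show "dim {z. p \<bullet> z = 0} \<le> dim (range L)"
      using dim_hyperplane[OF p0] dim by simp
  qed
  then have LG: "L (G z) = z - (z \<bullet> p) *\<^sub>R p" for z
  proof -
    have "p \<bullet> (z - (z \<bullet> p) *\<^sub>R p) = 0" by (simp add: inner_diff_right pp inner_commute)
    then obtain w where w: "z - (z \<bullet> p) *\<^sub>R p = L w"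
      using \<open>range L = _\<close> by blast
    then have "z = L w + (z \<bullet> p) *\<^sub>R p" by (simp add: algebra_simps)
    then have "G z = w"
      by (metis GL Gp add.right_neutral lG linear_add linear_cmul scaleR_zero_right)
    then show ?thesis using w by simp
  qed
  have G_m [measurable]: "G \<in> borel_measurable borel"
    by (intro borel_measurable_continuous_onI linear_continuous_on) (simp add: lG linear_conv_bounded_linear[symmetric])
  have L_m [measurable]: "L \<in> borel_measurable borel"
    by (intro borel_measurable_continuous_onI linear_continuous_on) (simp add: lin linear_conv_bounded_linear[symmetric])
  let ?M = "distr usphere borel (\<lambda>z. sgn (G z))"
  have "?M = usphere"
  proof (rule invariant_measure_eq_usphere)
    show "prob_space ?M" by (rule prob_space.prob_space_distr[OF prob_space_usphere]) simp
    show "AE w in ?M. norm w = 1"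
    proof (subst AE_distr_iff)
      have "dim (span {p}) \<le> card {p}" by (simp add: dim_le_card')
      then have "AE z in usphere. z \<notin> span {p}"
        using dim DIM_positive[where 'a = 'b] by (intro AE_usphere_notin_subspace) auto
      then show "AE z in usphere. norm (sgn (G z)) = 1"
      proof eventually_elim
        fix z assume z: "z \<notin> span {p}"
        have "G z \<noteq> 0"
        proof
          assume "G z = 0"
          then have "z = (z \<bullet> p) *\<^sub>R p" using LG[of z] linear_0[OF lin] by simp
          then show False using z by (metis insertI1 span_base span_scale)
        qed
        then show "norm (sgn (G z)) = 1" by (simp add: norm_sgn)
      qed
    qed auto
    fix U :: "'b \<Rightarrow> 'b" assume U: "orthogonal_transformation U"
    have lU: "linear U" using U by (rule orthogonal_transformation_linear)
    note [measurable] = orthogonal_transformation_measurable[OF U]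
    \<comment> \<open>\<open>T\<close> extends \<open>U\<close> to the large space: it fixes
      \<open>p\<close> and acts as \<open>U\<close> on the hyperplane. Invariance of
      \<open>usphere\<close> under \<open>T\<close> gives invariance of \<open>?M\<close> under
      \<open>U\<close>.\<close>
    define T where "T z = (z \<bullet> p) *\<^sub>R p + L (U (G z))" for z
    have GT: "G (T z) = U (G z)" for z
      by (simp add: T_def linear_add[OF lG] linear_cmul[OF lG] Gp GL)
    have "T z \<bullet> T w = z \<bullet> w" for z w
    proof -
      have "T z \<bullet> T w = (z \<bullet> p) * (w \<bullet> p) + G z \<bullet> G w"
        using U by (simp add: T_def inner_add_left inner_add_right pp Lp inner_L inner_commute[of "L _" p]
            orthogonal_transformation_def)
      also have "G z \<bullet> G w = z \<bullet> w - (z \<bullet> p) * (w \<bullet> p)"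
        by (simp add: G LG inner_diff_right)
      finally show ?thesis by simp
    qed
    moreover have "linear T"
      by (intro linearI) (simp_all add: T_def inner_add_left scaleR_add_left scaleR_add_right
          linear_add[OF lin] linear_cmul[OF lin] linear_add[OF lG] linear_cmul[OF lG]
          linear_add[OF lU] linear_cmul[OF lU])
    ultimately have T: "orthogonal_transformation T" by (simp add: orthogonal_transformation_def)
    note [measurable] = orthogonal_transformation_measurable[OF T]
    have "distr ?M borel U = distr usphere borel (\<lambda>z. sgn (G (T z)))"
      by (subst distr_distr) (auto simp: o_def GT sgn_orthogonal[OF U])
    also have "\<dots> = distr (distr usphere borel T) borel (\<lambda>z. sgn (G z))"
      by (subst distr_distr) (auto simp: o_def)
    finally show "distr ?M borel U = ?M" by (simp add: usphere_distr_orthogonal[OF T])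
  qed simp
  have LA: "{w. L w \<in> A} \<in> sets borel"
    using measurable_sets[OF L_m A] by (simp add: vimage_def)
  have "sgn (z - (z \<bullet> p) *\<^sub>R p) = L (sgn (G z))" for z
    by (simp add: LG[symmetric] sgn_div_norm iso linear_cmul[OF lin])
  then have "emeasure usphere {z. sgn (z - (z \<bullet> p) *\<^sub>R p) \<in> A} = emeasure ?M {w. L w \<in> A}"
    using LA by (subst emeasure_distr) (auto simp: vimage_def)
  then show ?thesis by (simp add: \<open>?M = usphere\<close>)
qed

section \<open>Simplex-avoiding sets\<close>

lemma prob_space_sphere_measure: "prob_space (sphere_measure :: 'a::euclidean_space measure)"
  by (rule prob_spaceI) (simp add: space_sphere_measure emeasure_sphere_measure_sphere)

lemma sphere_measure_borel:
  fixes A :: "'a::euclidean_space set"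
  assumes A: "A \<in> sets borel" "A \<subseteq> sphere 0 1"
  shows "A \<in> sets sphere_measure" and "measure sphere_measure A = measure usphere A"
proof -
  have "A \<in> sets (restrict_space usphere (sphere 0 1))"
    using A by (subst sets_restrict_space_iff) auto
  moreover have "emeasure (restrict_space usphere (sphere 0 1)) A = emeasure usphere A"
    using A by (intro emeasure_restrict_space) auto
  ultimately show "A \<in> sets sphere_measure" "measure sphere_measure A = measure usphere A"
    by (auto simp: sphere_measure_eq measure_def intro: sets_completionI_sets)
qed

text \<open>The Borel main part of a set measurable for the completion has full measure in it.
  Subsets of avoiding sets avoid simplices, so this reduces the bound to Borel sets.\<close>

lemma sphere_measure_inner_borel:
  fixes I :: "'a::euclidean_space set"
  assumes "I \<in> sets sphere_measure"
  obtains B where "B \<subseteq> I" "B \<in> sets borel" "B \<subseteq> sphere 0 1"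
    "measure usphere B = measure sphere_measure I"
proof -
  let ?M = "restrict_space usphere (sphere (0::'a) 1)"
  let ?B = "main_part ?M I"
  have I: "I \<in> sets (completion ?M)" using assms by (simp add: sphere_measure_eq)
  have B: "?B \<in> sets ?M" using I by simp
  then have B1: "?B \<in> sets borel" "?B \<subseteq> sphere 0 1"
    by (subst (asm) sets_restrict_space_iff; auto)+
  have "?B \<subseteq> I" using main_part_null_part_Un[OF I] by blast
  moreover have "measure sphere_measure I = measure sphere_measure ?B"
    using I B by (simp add: sphere_measure_eq measure_def)
  ultimately show ?thesis using that[of ?B] B1 sphere_measure_borel(2)[OF B1] by simp
qed

lemma integral_sphere_measure:
  fixes g :: "'a::euclidean_space \<Rightarrow> real"
  assumes [measurable]: "g \<in> borel_measurable borel"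
  shows "(LINT x|sphere_measure. g x) = (LINT x|usphere. g x)"
proof -
  have [measurable]: "sphere (0::'a) 1 \<in> sets borel" by simp
  have "(LINT x|sphere_measure. g x) = (LINT x|restrict_space usphere (sphere 0 1). g x)"
    unfolding sphere_measure_eq by (intro integral_completion measurable_restrict_space1) simp
  also have "\<dots> = (LINT x|usphere. indicator (sphere 0 1) x *\<^sub>R g x)"
    by (subst integral_restrict_space) (auto simp: set_lebesgue_integral_def)
  also have "\<dots> = (LINT x|usphere. g x)"
  proof (rule integral_cong_AE)
    show "AE x in usphere. indicator (sphere 0 1) x *\<^sub>R g x = g x"
      using AE_usphere_norm by eventually_elim simp
  qed auto
  finally show ?thesis .
qed

lemma frame_kernel_le_1: "I \<in> sets borel \<Longrightarrow> frame_kernel I x y \<le> 1"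
  unfolding frame_kernel_def
  by (rule frame.integral_le_const[OF integrable_frame_kernel]) (auto simp: indicator_def)

lemma measurable_frame_kernel [measurable]:
  assumes [measurable]: "I \<in> sets borel"
  shows "(\<lambda>(x, y). frame_kernel I x y) \<in> borel_measurable (borel \<Otimes>\<^sub>M borel)"
  unfolding frame_kernel_def by measurable

lemma integral_frame_kernel:
  fixes I :: "'a::euclidean_space set"
  assumes I [measurable]: "I \<in> sets borel"
  shows "(LINT x|usphere. LINT y|usphere. frame_kernel I x y) = (measure usphere I)\<^sup>2"
proof -
  have int1: "integrable usphere (\<lambda>y. frame_kernel I x y)" for x
    by (rule usphere.integrable_const_bound[where B = 1])
      (auto simp: frame_kernel_nonneg frame_kernel_le_1)
  have le1: "(LINT y|usphere. frame_kernel I x y) \<le> 1" for x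
    by (rule usphere.integral_le_const[OF int1]) (auto simp: frame_kernel_le_1)
  have ge0: "(LINT y|usphere. frame_kernel I x y) \<ge> 0" for x
    by (rule integral_nonneg_AE) (simp add: frame_kernel_nonneg)
  have int2: "integrable usphere (\<lambda>x. LINT y|usphere. frame_kernel I x y)"
    by (rule usphere.integrable_const_bound[where B = 1]) (auto simp: ge0 le1)
  have "ennreal (LINT x|usphere. LINT y|usphere. frame_kernel I x y)
    = (\<integral>\<^sup>+x. ennreal (LINT y|usphere. frame_kernel I x y) \<partial>usphere)"
    by (rule nn_integral_eq_integral[OF int2, symmetric]) (simp add: ge0)
  also have "\<dots> = (\<integral>\<^sup>+x. \<integral>\<^sup>+y. ennreal (frame_kernel I x y) \<partial>usphere \<partial>usphere)"
    by (intro nn_integral_cong nn_integral_eq_integral[OF int1, symmetric]) (simp add: frame_kernel_nonneg)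
  also have "\<dots> = ennreal ((measure usphere I)\<^sup>2)"
    by (simp add: nn_integral_frame_kernel usphere.emeasure_eq_measure ennreal_power)
  finally show ?thesis by (simp add: integral_nonneg_AE ge0)
qed

section \<open>Sections of avoiding sets\<close>

lemma measure_le_alpha_m:
  fixes I :: "'a::euclidean_space set"
  assumes "I \<in> sets sphere_measure" "avoids_simplices k t I"
  shows "measure sphere_measure I \<le> alpha_m TYPE('a) k t"
  unfolding alpha_m_def
proof (rule cSup_upper)
  show "bdd_above {measure sphere_measure I |I :: 'a set. I \<in> sets sphere_measure \<and> avoids_simplices k t I}"
    by (rule bdd_aboveI[of _ 1]) (auto intro: prob_space.prob_le_1[OF prob_space_sphere_measure])
qed (use assms in auto)

text \<open>
  A simplex in the section, together with \<open>p\<close>, would be a larger simplex in \<open>I\<close>. The parameter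
  \<open>t / (1 + t)\<close> solves \<open>t\<^sup>2 + (1 - t\<^sup>2) s = t\<close> for \<open>s\<close>.
\<close>

lemma avoids_simplices_section:
  fixes I :: "'a::euclidean_space set" and L :: "'b::euclidean_space \<Rightarrow> 'a"
  assumes avoids: "avoids_simplices k t I" and p: "p \<in> I" "norm p = 1" and I: "I \<subseteq> sphere 0 1"
    and lin: "linear L" and iso: "\<And>w. norm (L w) = norm w" and Lp: "\<And>w. p \<bullet> L w = 0"
    and t: "-1 < t" "t < 1"
  shows "avoids_simplices (k - 1) (t / (1 + t)) {w. t *\<^sub>R p + sqrt (1 - t\<^sup>2) *\<^sub>R L w \<in> I}"
  unfolding avoids_simplices_def
proof
  let ?s = "sqrt (1 - t\<^sup>2)"
  let ?\<phi> = "\<lambda>w. t *\<^sub>R p + ?s *\<^sub>R L w"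
  assume "\<exists>X\<subseteq>{w. ?\<phi> w \<in> I}. is_simplex (k - 1) (t / (1 + t)) X"
  then obtain X where "X \<subseteq> {w. ?\<phi> w \<in> I}" "is_simplex (k - 1) (t / (1 + t)) X" by blast
  then have X: "\<And>w. w \<in> X \<Longrightarrow> ?\<phi> w \<in> I" and k: "2 \<le> k - 1" and card: "card X = k - 1"
    and ip: "\<And>x y. x \<in> X \<Longrightarrow> y \<in> X \<Longrightarrow> x \<noteq> y \<Longrightarrow> x \<bullet> y = t / (1 + t)"
    by (auto simp: is_simplex_def)
  have t2: "t\<^sup>2 < 1" using t by (simp add: abs_square_less_1)
  have pp: "p \<bullet> p = 1" using p by (simp add: dot_square_norm)
  have inner_L: "L v \<bullet> L w = v \<bullet> w" for v w
    using iso[of "v + w"] iso[of v] iso[of w] by (simp add: linear_add[OF lin] dot_norm)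
  have p\<phi>: "p \<bullet> ?\<phi> w = t" for w by (simp add: inner_add_right pp Lp)
  have \<phi>\<phi>: "?\<phi> v \<bullet> ?\<phi> w = t\<^sup>2 + (1 - t\<^sup>2) * (v \<bullet> w)" for v w
  proof -
    have "?\<phi> v \<bullet> ?\<phi> w = t * t + (?s * ?s) * (v \<bullet> w)"
      by (simp add: inner_add_left inner_add_right pp Lp inner_L inner_commute[of "L _" p])
    also have "?s * ?s = 1 - t\<^sup>2" using t2 by simp
    finally show ?thesis by (simp add: power2_eq_square)
  qed
  \<comment> \<open>The factor \<open>?s\<close> is nonzero and \<open>L\<close> is an isometry, so
    the lifted simplex keeps its \<open>k - 1\<close> points; \<open>p\<close> then supplies the
    missing one.\<close>
  have "inj ?\<phi>"
  proof (rule injI)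
    fix v w assume "?\<phi> v = ?\<phi> w"
    then have "L v = L w" using t2 by simp
    then have "norm (L (v - w)) = 0" by (simp add: linear_diff[OF lin])
    then show "v = w" by (simp add: iso)
  qed
  then have "card (?\<phi> ` X) = k - 1" using card by (simp add: card_image inj_on_subset)
  moreover have "finite X" using card k by (intro card_ge_0_finite) simp
  moreover have "p \<notin> ?\<phi> ` X"
  proof
    assume "p \<in> ?\<phi> ` X"
    then obtain w where "p = ?\<phi> w" by blast
    then have "p \<bullet> p = t" using p\<phi>[of w] by simp
    then show False using pp t by simp
  qed
  ultimately have "card (insert p (?\<phi> ` X)) = k" using k by simp
  moreover have ip\<phi>: "?\<phi> v \<bullet> ?\<phi> w = t" if "v \<in> X" "w \<in> X" "?\<phi> v \<noteq> ?\<phi> w" for v w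
  proof -
    have "v \<bullet> w = t / (1 + t)" using ip[of v w] that by blast
    then have "?\<phi> v \<bullet> ?\<phi> w = t\<^sup>2 + (1 - t\<^sup>2) * (t / (1 + t))" by (simp only: \<phi>\<phi>)
    also have "\<dots> = t" using t by (simp add: field_simps power2_eq_square)
    finally show ?thesis .
  qed
  moreover have "insert p (?\<phi> ` X) \<subseteq> I" using p X by auto
  moreover have "x \<bullet> y = t" if "x \<in> insert p (?\<phi> ` X)" "y \<in> insert p (?\<phi> ` X)" "x \<noteq> y" for x y
  proof -
    consider "x = p" "y \<in> ?\<phi> ` X" | "y = p" "x \<in> ?\<phi> ` X" | "x \<in> ?\<phi> ` X" "y \<in> ?\<phi> ` X"
      using \<open>x \<in> _\<close> \<open>y \<in> _\<close> \<open>x \<noteq> y\<close> by blast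
    then show ?thesis
    proof cases
      case 1
      then obtain w where "y = ?\<phi> w" by blast
      then show ?thesis using 1 p\<phi>[of w] by simp
    next
      case 2
      then obtain w where "x = ?\<phi> w" by blast
      then show ?thesis using 2 p\<phi>[of w] by (simp add: inner_commute[of _ p])
    next
      case 3
      then obtain v w where "v \<in> X" "w \<in> X" "x = ?\<phi> v" "y = ?\<phi> w" by blast
      then show ?thesis using ip\<phi>[of v w] \<open>x \<noteq> y\<close> by simp
    qed
  qed
  ultimately have "is_simplex k t (insert p (?\<phi> ` X))"
    unfolding is_simplex_def using k I by (intro conjI ballI impI) auto
  then show False using avoids \<open>insert p (?\<phi> ` X) \<subseteq> I\<close> by (auto simp: avoids_simplices_def)
qed

text \<open>Carried to the smaller space by \<open>L\<close>, the section becomes the Borel set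
  \<open>?J\<close> of the same measure, which avoids the smaller simplices.\<close>

lemma emeasure_section_le_alpha_m:
  fixes I :: "'a::euclidean_space set" and p :: 'a
  assumes dim: "DIM('a) = Suc DIM('b::euclidean_space)"
    and avoids: "avoids_simplices k t I" and I: "I \<in> sets borel" "I \<subseteq> sphere 0 1"
    and p: "p \<in> I" and t: "-1 < t" "t < 1"
  shows "emeasure usphere {z. t *\<^sub>R p + sqrt (1 - t\<^sup>2) *\<^sub>R sgn (z - (z \<bullet> p) *\<^sub>R p) \<in> I}
    \<le> ennreal (alpha_m TYPE('b) (k - 1) (t / (1 + t)))"
proof -
  let ?s = "sqrt (1 - t\<^sup>2)"
  have t2: "t\<^sup>2 < 1" using t by (simp add: abs_square_less_1)
  have p1: "norm p = 1" using p I by auto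
  then have "p \<noteq> 0" by auto
  then obtain L :: "'b \<Rightarrow> 'a" where L: "linear L" "\<And>w. norm (L w) = norm w" "\<And>w. p \<bullet> L w = 0"
    using isometry_onto_hyperplane_exists[OF _ dim] by blast
  let ?A = "{w. t *\<^sub>R p + ?s *\<^sub>R w \<in> I}" and ?J = "{w. t *\<^sub>R p + ?s *\<^sub>R L w \<in> I}"
  have "(\<lambda>w. t *\<^sub>R p + ?s *\<^sub>R w) \<in> borel_measurable borel" by measurable
  from measurable_sets[OF this I(1)] have A: "?A \<in> sets borel" by (simp add: vimage_def)
  have "L \<in> borel_measurable borel"
    by (intro borel_measurable_continuous_onI linear_continuous_on) (simp add: L(1) linear_conv_bounded_linear[symmetric])
  from measurable_sets[OF this A] have J: "?J \<in> sets borel" by (simp add: vimage_def)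
  \<comment> \<open>A lifted point has squared norm
    \<open>t\<^sup>2 + (1 - t\<^sup>2) * (norm w)\<^sup>2\<close>; as it lies on the unit sphere, so
    does \<open>w\<close>.\<close>
  have "?J \<subseteq> sphere 0 1"
  proof
    fix w assume "w \<in> ?J"
    then have "norm (t *\<^sub>R p + ?s *\<^sub>R L w) = 1" using I(2) by auto
    then have "1 = (t *\<^sub>R p + ?s *\<^sub>R L w) \<bullet> (t *\<^sub>R p + ?s *\<^sub>R L w)" by (simp add: dot_square_norm)
    also have "\<dots> = t * t * (p \<bullet> p) + (?s * ?s) * (L w \<bullet> L w)"
      by (simp add: inner_add_left inner_add_right L(3) inner_commute[of "L _" p])
    also have "\<dots> = t * t + (?s * ?s) * (norm w)\<^sup>2"
      using p1 by (simp only: dot_square_norm L(2)) simp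
    also have "\<dots> = t\<^sup>2 + (1 - t\<^sup>2) * (norm w)\<^sup>2"
      using t2 by (simp add: power2_eq_square)
    finally have "(1 - t\<^sup>2) * (norm w)\<^sup>2 = (1 - t\<^sup>2) * 1" by (simp add: algebra_simps)
    then have "(norm w)\<^sup>2 = 1" using t2 by (subst (asm) mult_cancel_left) simp
    then have "norm w = 1" using power2_eq_1_iff[of "norm w"] norm_ge_zero[of w] by auto
    then show "w \<in> sphere 0 1" by simp
  qed
  note J = J this
  have "measure usphere ?J \<le> alpha_m TYPE('b) (k - 1) (t / (1 + t))"
    using measure_le_alpha_m[OF sphere_measure_borel(1)[OF J]
        avoids_simplices_section[OF avoids p p1 I(2) L t]] sphere_measure_borel(2)[OF J] by simp
  moreover have "emeasure usphere {z. t *\<^sub>R p + ?s *\<^sub>R sgn (z - (z \<bullet> p) *\<^sub>R p) \<in> I} = emeasure usphere ?J"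
    using emeasure_usphere_section[OF p1 dim L A] by simp
  ultimately show ?thesis by (simp add: usphere.emeasure_eq_measure ennreal_leI)
qed

section \<open>Admissible functions and the final bound\<close>

lemma positive_type_le_1:
  fixes x y :: "'a::euclidean_space"
  assumes f: "positive_type TYPE('a) f" "f 1 = 1" and xy: "norm x = 1" "norm y = 1"
  shows "f (x \<bullet> y) \<le> 1"
proof (cases "x = y")
  case True
  then show ?thesis using f(2) xy by (simp add: dot_square_norm)
next
  case False
  \<comment> \<open>Coefficients \<open>1\<close> and \<open>-1\<close> reduce positivity to
    \<open>2 * f 1 - 2 * f (x \<bullet> y) \<ge> 0\<close>.\<close>
  let ?c = "\<lambda>z. if z = x then 1 else - 1 :: real"
  have "0 \<le> (\<Sum>u\<in>{x, y}. \<Sum>v\<in>{x, y}. ?c u * f (u \<bullet> v) * ?c v)"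
    using f(1)[unfolded positive_type_def, rule_format, of "{x, y}" ?c] xy by simp
  then show ?thesis
    using False f(2) xy by (auto simp: dot_square_norm inner_commute[of y x])
qed

text \<open>The Bochner integral of a non-integrable function is \<open>0\<close> by convention, so
  the pointwise bound passes to the integral in either case.\<close>

lemma (in prob_space) integral_le_1:
  fixes g :: "'a \<Rightarrow> real"
  assumes "\<And>x. x \<in> space M \<Longrightarrow> g x \<le> 1"
  shows "(LINT x|M. g x) \<le> 1"
proof (cases "integrable M g")
  case True
  then show ?thesis using assms by (intro integral_le_const) auto
qed (simp add: not_integrable_integral_eq)

text \<open>Points of a small cap are too close together to have inner product \<open>t\<close>.
  Such caps show that the suprema involved are over nonempty sets and are nonnegative.\<close>

lemma small_cap_avoids_simplices:
  fixes t :: real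
  assumes t: "t < 1"
  obtains C :: "'a::euclidean_space set"
    where "C \<in> sets borel" "C \<subseteq> sphere 0 1" "avoids_simplices k t C" "measure usphere C > 0"
proof -
  obtain e :: 'a where e: "norm e = 1" using vector_choose_size[of 1] by auto
  \<comment> \<open>Unit vectors with inner product \<open>t\<close> have distance
    \<open>2 * d\<close>, while two points of an open ball of radius \<open>d\<close> are closer
    than that.\<close>
  define d where "d = sqrt ((1 - t) / 2)"
  have d: "d > 0" and dd: "d * d = (1 - t) / 2" using t by (auto simp: d_def)
  define C where "C = sphere 0 1 \<inter> ball e d"
  have C: "C \<in> sets borel" "C \<subseteq> sphere 0 1" by (auto simp: C_def)
  have "emeasure usphere (ball e d) = emeasure usphere C"
  proof (rule emeasure_eq_AE)
    show "AE x in usphere. x \<in> ball e d \<longleftrightarrow> x \<in> C"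
      using AE_usphere_norm by eventually_elim (simp add: C_def)
  qed (use C in auto)
  then have pos: "measure usphere C > 0"
    using usphere_ball_pos[OF e d] by (simp add: usphere.emeasure_eq_measure)
  have ip: "x \<bullet> y \<noteq> t" if "x \<in> C" "y \<in> C" for x y
  proof -
    have xy: "norm x = 1" "norm y = 1" using that by (auto simp: C_def)
    have "dist x y < 2 * d"
      using that dist_triangle_less_add[of x e d y d] by (auto simp: C_def dist_commute)
    then have "(norm (x - y))\<^sup>2 < (2 * d)\<^sup>2"
      by (intro power_strict_mono) (auto simp: dist_norm)
    also have "\<dots> = 2 * (1 - t)" using dd by (simp add: power2_eq_square)
    also have "(norm (x - y))\<^sup>2 = 2 - 2 * (x \<bullet> y)"
      using xy by (simp add: dot_square_norm[symmetric] inner_diff_left inner_diff_right inner_commute)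
        (simp add: dot_square_norm)
    finally show ?thesis by auto
  qed
  have "avoids_simplices k t C"
    unfolding avoids_simplices_def
  proof
    assume "\<exists>X\<subseteq>C. is_simplex k t X"
    then obtain X where X: "X \<subseteq> C" "2 \<le> card X" "\<And>x y. x \<in> X \<Longrightarrow> y \<in> X \<Longrightarrow> x \<noteq> y \<Longrightarrow> x \<bullet> y = t"
      unfolding is_simplex_def by blast
    obtain x y where "x \<in> X" "y \<in> X" "x \<noteq> y"
      using X(2) by (metis card_le_Suc0_iff_eq card.infinite not_less_eq_eq numeral_2_eq_2 zero_le)
    then show False using X(1,3) ip by blast
  qed
  then show ?thesis using that C pos by blast
qed

lemma autocorrelation_function:
  fixes I :: "'a::euclidean_space set"
  assumes dim: "DIM('a) = Suc DIM('b::euclidean_space)"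
    and avoids: "avoids_simplices k t I" and I [measurable]: "I \<in> sets borel" and sph: "I \<subseteq> sphere 0 1"
    and t: "-1 < t" "t < 1" and pos: "measure usphere I > 0"
  obtains f where "continuous_on {-1..1} f" "positive_type TYPE('a) f" "f 1 = 1"
    "f t \<le> alpha_m TYPE('b) (k - 1) (t / (1 + t))"
    "(LINT x|(sphere_measure :: 'a measure). LINT y|sphere_measure. f (x \<bullet> y)) = measure usphere I"
proof -
  let ?m = "measure usphere I"
  have dim2: "DIM('a) \<ge> 2" using dim DIM_positive[where 'a = 'b] by linarith
  obtain e0 e1 :: 'a where e: "norm e0 = 1" "norm e1 = 1" "e0 \<bullet> e1 = 0"
  proof -
    have "\<not> DIM('a) \<le> Suc 0" using dim2 by simp
    then obtain a b :: 'a where "a \<in> Basis" "b \<in> Basis" "a \<noteq> b"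
      using card_le_Suc0_iff_eq[OF finite_Basis] by blast
    then show ?thesis using that[of a b] by (simp add: inner_Basis)
  qed
  \<comment> \<open>A continuous choice of a unit vector at inner product \<open>u\<close> with
    \<open>e0\<close>, through which the kernel becomes a function of one real variable.\<close>
  define arc where "arc u = u *\<^sub>R e0 + sqrt (1 - u\<^sup>2) *\<^sub>R e1" for u
  have arc: "norm (arc u) = 1" "e0 \<bullet> arc u = u" if "u \<in> {-1..1}" for u
  proof -
    have u: "u\<^sup>2 \<le> 1" using that by (simp add: abs_square_le_1 abs_le_iff)
    have "e0 \<bullet> e0 = 1" "e1 \<bullet> e1 = 1" using e by (simp_all add: dot_square_norm)
    then have "arc u \<bullet> arc u = u * u + sqrt (1 - u\<^sup>2) * sqrt (1 - u\<^sup>2)" "e0 \<bullet> arc u = u"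
      using e(3) by (simp_all add: arc_def inner_add_left inner_add_right inner_commute[of e1 e0])
    then show "norm (arc u) = 1" "e0 \<bullet> arc u = u"
      using u by (simp_all add: norm_eq_sqrt_inner power2_eq_square)
  qed
  \<comment> \<open>Dividing by \<open>?m\<close>, the diagonal value of the kernel, gives
    \<open>f 1 = 1\<close>.\<close>
  define f where "f u = frame_kernel I e0 (arc u) / ?m" for u
  have f: "f (x \<bullet> y) = frame_kernel I x y / ?m" if "norm x = 1" "norm y = 1" for x y
  proof -
    have "x \<bullet> y \<in> {-1..1}" using Cauchy_Schwarz_ineq2[of x y] that by (simp add: abs_le_iff)
    then show ?thesis
      using frame_kernel_invariant[OF I, of e0 x "arc (x \<bullet> y)" y] arc[of "x \<bullet> y"] that e
      by (simp add: f_def)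
  qed
  have "continuous_on {-1..1} f"
  proof -
    have "continuous_on {-1..1} arc"
      unfolding arc_def by (intro continuous_intros)
    moreover have "arc ` {-1..1} \<subseteq> sphere 0 1" using arc by auto
    ultimately have "continuous_on {-1..1} (\<lambda>u. frame_kernel I e0 (arc u))"
      by (rule continuous_on_compose2[OF frame_kernel_continuous[OF I]])
    then show ?thesis unfolding f_def by (intro continuous_on_divide) (use pos in auto)
  qed
  moreover have "positive_type TYPE('a) f"
    unfolding positive_type_def
  proof (intro allI impI)
    fix U :: "'a set" and c :: "'a \<Rightarrow> real" assume U: "finite U" "U \<subseteq> sphere 0 1"
    have "(\<Sum>x\<in>U. \<Sum>y\<in>U. c x * f (x \<bullet> y) * c y)
      = (\<Sum>x\<in>U. \<Sum>y\<in>U. c x * frame_kernel I x y * c y) / ?m"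
      unfolding sum_divide_distrib
      using U(2) by (intro sum.cong refl) (auto simp: f subset_iff)
    then show "0 \<le> (\<Sum>x\<in>U. \<Sum>y\<in>U. c x * f (x \<bullet> y) * c y)"
      using frame_kernel_psd[OF I U(1), of c] by simp
  qed
  moreover have "f 1 = 1"
    using f[of e0 e0] frame_kernel_diag[OF I e(1)] pos e by (simp add: dot_square_norm)
  moreover have "f t \<le> alpha_m TYPE('b) (k - 1) (t / (1 + t))"
  proof -
    let ?a = "alpha_m TYPE('b) (k - 1) (t / (1 + t))"
    have bound: "emeasure usphere {z. t *\<^sub>R p + sqrt (1 - t\<^sup>2) *\<^sub>R sgn (z - (z \<bullet> p) *\<^sub>R p) \<in> I} \<le> ennreal ?a"
      if "p \<in> I" for p
      by (rule emeasure_section_le_alpha_m[OF dim avoids I sph that t])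
    \<comment> \<open>This makes a cap available in the smaller space, and its measure shows
      \<open>?a \<ge> 0\<close>.\<close>
    have "t / (1 + t) < 1" using t by (simp add: field_simps)
    then obtain C :: "'b set" where C: "C \<in> sets borel" "C \<subseteq> sphere 0 1"
      "avoids_simplices (k - 1) (t / (1 + t)) C" "measure usphere C > 0"
      by (rule small_cap_avoids_simplices)
    have "?a \<ge> 0"
      using measure_le_alpha_m[OF sphere_measure_borel(1)[OF C(1,2)] C(3)] measure_nonneg
      by (rule order_trans[rotated])
    then have "frame_kernel I e0 (arc t) \<le> ?a * ?m"
      using t e by (intro frame_kernel_section_bound[OF dim2 I t _ _ _ _ bound]) (auto simp: arc)
    then show ?thesis using pos by (simp add: f_def field_simps)
  qed
  moreover have "(LINT x|(sphere_measure :: 'a measure). LINT y|sphere_measure. f (x \<bullet> y)) = ?m"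
  proof -
    have "(LINT x|(sphere_measure :: 'a measure). LINT y|sphere_measure. f (x \<bullet> y))
      = (LINT x|(sphere_measure :: 'a measure). LINT y|sphere_measure. frame_kernel I x y / ?m)"
      by (intro Bochner_Integration.integral_cong refl) (simp add: f space_sphere_measure)
    also have "\<dots> = (LINT x|(sphere_measure :: 'a measure). LINT y|usphere. frame_kernel I x y) / ?m"
      by (simp add: integral_sphere_measure)
    also have "\<dots> = ?m\<^sup>2 / ?m"
      by (simp add: integral_sphere_measure integral_frame_kernel[OF I])
    finally show ?thesis using pos by (simp add: power2_eq_square)
  qed
  ultimately show ?thesis by (rule that)
qed

text \<open>The unit spheres of \<open>real ^ 'n\<close> and \<open>real ^ 'm\<close> stand for the
  spheres of dimensions \<open>n - 1\<close> and \<open>n - 2\<close>.\<close>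

theorem theorem2p1:
  fixes n k :: nat and t \<gamma> :: real
  assumes "CARD('n::finite) = n" and "CARD('m::finite) = n - 1"
    and "n \<ge> k" and "k \<ge> 3"
    and "t \<in> {- 1 / (real k - 1) ..< 1}"
    and "\<gamma> \<ge> 0"
    and "\<gamma> \<ge> alpha_m TYPE(real ^ 'm) (k - 1) (t / (1 + t))"
  shows "alpha_m TYPE(real ^ 'n) k t
    \<le> Sup {LINT x|(sphere_measure :: (real ^ 'n) measure). LINT y|sphere_measure. f (x \<bullet> y) | f.
            continuous_on {-1..1} f \<and> positive_type TYPE(real ^ 'n) f \<and> f 1 = 1 \<and> f t \<le> \<gamma>}"
    (is "_ \<le> Sup ?S")
proof -
  have dim: "DIM(real ^ 'n) = Suc DIM(real ^ 'm)" using assms(1-4) by simp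
  \<comment> \<open>As \<open>k \<ge> 3\<close>, the left end of the interval is at least
    \<open>-1/2\<close>, so \<open>1 + t\<close> is positive.\<close>
  have "- 1 < - 1 / (real k - 1)" using assms(4) by (simp add: field_simps)
  then have t: "-1 < t" "t < 1" using assms(5) by auto
  \<comment> \<open>A real \<open>Sup\<close> is an upper bound only for a bounded set.\<close>
  have bdd: "bdd_above ?S"
  proof (rule bdd_aboveI[of _ 1])
    fix s assume "s \<in> ?S"
    then obtain f where f: "positive_type TYPE(real ^ 'n) f" "f 1 = 1"
      and s: "s = (LINT x|(sphere_measure :: (real ^ 'n) measure). LINT y|sphere_measure. f (x \<bullet> y))"
      by blast
    show "s \<le> 1"
      unfolding s by (intro prob_space.integral_le_1[OF prob_space_sphere_measure] positive_type_le_1[OF f])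
        (auto simp: space_sphere_measure)
  qed
  have upper: "measure usphere B \<le> Sup ?S"
    if B: "avoids_simplices k t B" "B \<in> sets borel" "B \<subseteq> sphere 0 1" "measure usphere B > 0"
    for B :: "(real ^ 'n) set"
  proof -
    obtain f where f: "continuous_on {-1..1} f" "positive_type TYPE(real ^ 'n) f" "f 1 = 1"
      "f t \<le> alpha_m TYPE(real ^ 'm) (k - 1) (t / (1 + t))"
      "(LINT x|(sphere_measure :: (real ^ 'n) measure). LINT y|sphere_measure. f (x \<bullet> y)) = measure usphere B"
      by (rule autocorrelation_function[OF dim B(1-3) t B(4)])
    have "f t \<le> \<gamma>" using f(4) assms(7) by linarith
    then have "measure usphere B \<in> ?S"
      by (intro CollectI exI[of _ f] conjI f(1-3) f(5)[symmetric])
    then show ?thesis by (rule cSup_upper[OF _ bdd])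
  qed
  show ?thesis
    unfolding alpha_m_def
  proof (rule cSup_least)
    obtain C :: "(real ^ 'n) set" where C: "C \<in> sets borel" "C \<subseteq> sphere 0 1"
      "avoids_simplices k t C" "measure usphere C > 0"
      by (rule small_cap_avoids_simplices[OF t(2)])
    show "{measure sphere_measure I |I :: (real ^ 'n) set. I \<in> sets sphere_measure \<and> avoids_simplices k t I} \<noteq> {}"
      using sphere_measure_borel(1)[OF C(1,2)] C(3) by blast
    \<comment> \<open>The autocorrelation function divides by the measure of the set, so null sets
      are covered by nonnegativity of the supremum instead.\<close>
    have "0 \<le> Sup ?S" using upper[OF C(3,1,2,4)] C(4) by linarith
    fix s assume "s \<in> {measure sphere_measure I |I :: (real ^ 'n) set.
      I \<in> sets sphere_measure \<and> avoids_simplices k t I}"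
    then obtain I :: "(real ^ 'n) set" where I: "I \<in> sets sphere_measure" "avoids_simplices k t I"
      and s: "s = measure sphere_measure I" by blast
    obtain B where B: "B \<subseteq> I" "B \<in> sets borel" "B \<subseteq> sphere 0 1" "measure usphere B = s"
      using sphere_measure_inner_borel[OF I(1)] s by blast
    have "avoids_simplices k t B" using I(2) B(1) unfolding avoids_simplices_def by blast
    then show "s \<le> Sup ?S"
      using upper[of B] B \<open>0 \<le> Sup ?S\<close> measure_nonneg[of usphere B] by force
  qed
qed

end
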